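(* Let $(A,B)$ be a Pythagorean pair acting on a complex Hilbert space $\mathfrak H$, with associated Pythagorean representation $\sigma=\sigma_{A,B}:F\to\mathcal U(\mathscr H)$ of Thompson's group $F$. If $\lim_{n\to\infty}A^n\xi=\lim_{n\to\infty}B^n\xi=0$ for all $\xi\in\mathfrak H$, then $\sigma$ is weakly mixing, i.e. $\sigma$ does not contain any non-zero finite-dimensional subrepresentation.
   Context: All Hilbert spaces are complex, all groups are discrete, all representations are unitary. A subrepresentation is a closed invariant subspace. Trees and forests. A tree is a finite non-empty rooted binary tree in which each vertex has either no children (a leaf) or exactly two children (left and right); it is viewed as a rooted subtree of the infinite rooted binary tree, and its leaves are ordered from left to right. $\mathrm{Leaf}(t)$ is the set of leaves of $t$. A forest is a finite ordered list of trees; its roots and leaves are ordered from left to right. If a forest $f$ has as many roots as $t$ has leaves, $f\circ t$ is the tree obtained by attaching the $j$th tree of $f$ at the $j$th leaf of $t$. Composition of forests is defined similarly. Write $t\preceq s$ if $t$ is a rooted subtree of $s$, equivalently $s=f\circ t$ for a (unique) forest $f$. Thompson's group $F$. $F$ is the set of classes $[t,s]$ of pairs of trees with the same number of leaves, for the equivalence relation generated by $(f\circ t,f\circ s)\sim(t,s)$, with product $[t,s][t',s']=[f\circ t,f'\circ s']$ for any forests $f,f'$ with $f\circ s=f'\circ t'$; then $[t,s]^{-1}=[s,t]$. Pythagorean pair. A pair of bounded operators $(A,B)$ on a Hilbert space $\mathfrak H$ with $A^*A+B^*B=\mathrm{id}_{\mathfrak H}$. Pythagorean representation. For a tree $t$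 let $\mathfrak H_t=\ell^2(\mathrm{Leaf}(t),\mathfrak H)\cong\mathfrak H^{\oplus n}$, where $n=|\mathrm{Leaf}(t)|$; elements are written $(t,\xi)$, decorations of the leaves of $t$ by vectors of $\mathfrak H$. For the forest $f_{k,n}$ with $n$ roots, all of whose trees are trivial except the $k$th which has two leaves, set $\Phi(f_{k,n})(\xi_1,\dots,\xi_n)=(\xi_1,\dots,\xi_{k-1},A\xi_k,B\xi_k,\xi_{k+1},\dots,\xi_n)$, and extend $\Phi$ to all forests by $\Phi(f\circ g)=\Phi(f)\Phi(g)$ (this is well-defined, and each $\Phi(f)$ is an isometry). The maps $\mathfrak H_t\to\mathfrak H_{f\circ t}$, $(t,\xi)\mapsto(f\circ t,\Phi(f)\xi)$, form a directed system of isometries indexed by the directed poset of trees; $\mathscr K$ is its direct limit (a pre-Hilbert space), with elements written $[t,\xi]$, and $\mathscr H$ is the completion of $\mathscr K$. The Pythagorean representation $\sigma=\sigma_{A,B}$ of $F$ on $\mathscr H$ is the unitary representation determined by $\sigma([t,s])[s,\xi]=[t,\xi]$ (given $g\in F$ and $z\in\mathscr K$ one can always choose representatives $g=[t,s]$, $z=[s,\xi]$ with a common tree $s$). *)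

theory Defs
  imports "HOL-Analysis.Analysis" "HOL-Algebra.Group"
begin

section \<open>Complex Hilbert spaces as types\<close>

text \<open>The inner product is antilinear in the first argument. The axioms inherited from
  \<open>real_normed_vector\<close> only say that the real scalar multiplication, the norm and the
  topology are the ones induced by the complex inner product.\<close>

class complex_inner = real_normed_vector +
  fixes scaleC :: "complex \<Rightarrow> 'a \<Rightarrow> 'a" (infixr \<open>*\<^sub>C\<close> 75)
    and cinner :: "'a \<Rightarrow> 'a \<Rightarrow> complex"
  assumes scaleC_add_right: "c *\<^sub>C (x + y) = c *\<^sub>C x + c *\<^sub>C y"
    and scaleC_add_left: "(c + d) *\<^sub>C x = c *\<^sub>C x + d *\<^sub>C x"
    and scaleC_scaleC: "c *\<^sub>C d *\<^sub>C x = (c * d) *\<^sub>C x"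
    and scaleR_scaleC: "r *\<^sub>R x = complex_of_real r *\<^sub>C x"
    and cinner_commute: "cinner x y = cnj (cinner y x)"
    and cinner_add_right: "cinner x (y + z) = cinner x y + cinner x z"
    and cinner_scaleC_right: "cinner x (c *\<^sub>C y) = c * cinner x y"
    and cinner_self: "cinner x x = complex_of_real ((norm x)\<^sup>2)"

class chilbert_space = complex_inner + complete_space

definition bounded_clinear :: "('a::complex_inner \<Rightarrow> 'b::complex_inner) \<Rightarrow> bool" where
  "bounded_clinear T \<longleftrightarrow>
     (\<forall>x y. T (x + y) = T x + T y) \<and> (\<forall>c x. T (c *\<^sub>C x) = c *\<^sub>C T x) \<and>
     (\<exists>K. \<forall>x. norm (T x) \<le> K * norm x)"

definition cadjoint :: "('a::complex_inner \<Rightarrow> 'b::complex_inner) \<Rightarrow> 'b \<Rightarrow> 'a" where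
  "cadjoint T = (SOME T'. \<forall>x y. cinner (T' y) x = cinner y (T x))"

definition pythagorean_pair :: "('h::chilbert_space \<Rightarrow> 'h) \<Rightarrow> ('h \<Rightarrow> 'h) \<Rightarrow> bool" where
  "pythagorean_pair A B \<longleftrightarrow> bounded_clinear A \<and> bounded_clinear B \<and>
     (\<lambda>x. cadjoint A (A x) + cadjoint B (B x)) = id"


section \<open>Complex inner product spaces on carrier sets\<close>

text \<open>The space of a Pythagorean representation depends on the operators \<open>A\<close> and \<open>B\<close>, so it
  cannot be a type; it is a carrier set with operations.\<close>

record 'v inner_space = "'v partial_object" +
  vadd :: "'v \<Rightarrow> 'v \<Rightarrow> 'v"
  vzero :: 'v
  vscale :: "complex \<Rightarrow> 'v \<Rightarrow> 'v"
  vinner :: "'v \<Rightarrow> 'v \<Rightarrow> complex"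

definition vnorm :: "('v, 'm) inner_space_scheme \<Rightarrow> 'v \<Rightarrow> real" where
  "vnorm S x = sqrt (Re (vinner S x x))"

text \<open>The guard is needed because \<open>Metric_space\<close> asks for symmetry and nonnegativity also
  outside the carrier.\<close>

definition vdist :: "('v, 'm) inner_space_scheme \<Rightarrow> 'v \<Rightarrow> 'v \<Rightarrow> real" where
  "vdist S x y =
     (if x \<in> carrier S \<and> y \<in> carrier S then vnorm S (vadd S x (vscale S (-1) y)) else 0)"

locale complex_inner_space =
  fixes S :: "('v, 'm) inner_space_scheme" (structure)
  assumes vadd_closed: "\<lbrakk>x \<in> carrier S; y \<in> carrier S\<rbrakk> \<Longrightarrow> vadd S x y \<in> carrier S"
    and vzero_closed: "vzero S \<in> carrier S"
    and vscale_closed: "x \<in> carrier S \<Longrightarrow> vscale S c x \<in> carrier S"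
    and vadd_assoc: "\<lbrakk>x \<in> carrier S; y \<in> carrier S; z \<in> carrier S\<rbrakk> \<Longrightarrow>
      vadd S (vadd S x y) z = vadd S x (vadd S y z)"
    and vadd_commute: "\<lbrakk>x \<in> carrier S; y \<in> carrier S\<rbrakk> \<Longrightarrow> vadd S x y = vadd S y x"
    and vadd_zero: "x \<in> carrier S \<Longrightarrow> vadd S x (vzero S) = x"
    and vadd_uminus: "x \<in> carrier S \<Longrightarrow> vadd S x (vscale S (-1) x) = vzero S"
    and vscale_add_right: "\<lbrakk>x \<in> carrier S; y \<in> carrier S\<rbrakk> \<Longrightarrow>
      vscale S c (vadd S x y) = vadd S (vscale S c x) (vscale S c y)"
    and vscale_add_left: "x \<in> carrier S \<Longrightarrow>
      vscale S (c + d) x = vadd S (vscale S c x) (vscale S d x)"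
    and vscale_vscale: "x \<in> carrier S \<Longrightarrow> vscale S c (vscale S d x) = vscale S (c * d) x"
    and vscale_one: "x \<in> carrier S \<Longrightarrow> vscale S 1 x = x"
    and vinner_commute: "\<lbrakk>x \<in> carrier S; y \<in> carrier S\<rbrakk> \<Longrightarrow> vinner S x y = cnj (vinner S y x)"
    and vinner_add_right: "\<lbrakk>x \<in> carrier S; y \<in> carrier S; z \<in> carrier S\<rbrakk> \<Longrightarrow>
      vinner S x (vadd S y z) = vinner S x y + vinner S x z"
    and vinner_scale_right: "\<lbrakk>x \<in> carrier S; y \<in> carrier S\<rbrakk> \<Longrightarrow>
      vinner S x (vscale S c y) = c * vinner S x y"
    and vinner_pos: "x \<in> carrier S \<Longrightarrow> 0 \<le> Re (vinner S x x)"
    and vinner_definite: "\<lbrakk>x \<in> carrier S; vinner S x x = 0\<rbrakk> \<Longrightarrow> x = vzero S"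

locale hilbert_space = complex_inner_space +
  assumes complete: "Metric_space.mcomplete (carrier S) (vdist S)"

definition lin_subspace :: "('v, 'm) inner_space_scheme \<Rightarrow> 'v set \<Rightarrow> bool" where
  "lin_subspace S W \<longleftrightarrow> W \<subseteq> carrier S \<and> vzero S \<in> W \<and>
     (\<forall>x\<in>W. \<forall>y\<in>W. vadd S x y \<in> W) \<and> (\<forall>c. \<forall>x\<in>W. vscale S c x \<in> W)"

definition finite_dimensional :: "('v, 'm) inner_space_scheme \<Rightarrow> 'v set \<Rightarrow> bool" where
  "finite_dimensional S W \<longleftrightarrow> (\<exists>E. finite E \<and> E \<subseteq> carrier S \<and> W = lin_subspace S hull E)"

definition unitary_operator :: "('v, 'm) inner_space_scheme \<Rightarrow> ('v \<Rightarrow> 'v) \<Rightarrow> bool" where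
  "unitary_operator S U \<longleftrightarrow> bij_betw U (carrier S) (carrier S) \<and>
     (\<forall>x\<in>carrier S. \<forall>y\<in>carrier S. U (vadd S x y) = vadd S (U x) (U y)) \<and>
     (\<forall>c. \<forall>x\<in>carrier S. U (vscale S c x) = vscale S c (U x)) \<and>
     (\<forall>x\<in>carrier S. \<forall>y\<in>carrier S. vinner S (U x) (U y) = vinner S x y)"

definition unitary_representation ::
    "('g, 'k) monoid_scheme \<Rightarrow> ('v, 'm) inner_space_scheme \<Rightarrow> ('g \<Rightarrow> 'v \<Rightarrow> 'v) \<Rightarrow> bool" where
  "unitary_representation G S \<pi> \<longleftrightarrow> (\<forall>g\<in>carrier G. unitary_operator S (\<pi> g)) \<and>
     (\<forall>g\<in>carrier G. \<forall>h\<in>carrier G. \<forall>x\<in>carrier S. \<pi> (g \<otimes>\<^bsub>G\<^esub> h) x = \<pi> g (\<pi> h x))"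

definition subrepresentation ::
    "('g, 'k) monoid_scheme \<Rightarrow> ('v, 'm) inner_space_scheme \<Rightarrow> ('g \<Rightarrow> 'v \<Rightarrow> 'v) \<Rightarrow> 'v set \<Rightarrow> bool" where
  "subrepresentation G S \<pi> W \<longleftrightarrow> lin_subspace S W \<and>
     closedin (Metric_space.mtopology (carrier S) (vdist S)) W \<and>
     (\<forall>g\<in>carrier G. \<forall>x\<in>W. \<pi> g x \<in> W)"

definition weakly_mixing ::
    "('g, 'k) monoid_scheme \<Rightarrow> ('v, 'm) inner_space_scheme \<Rightarrow> ('g \<Rightarrow> 'v \<Rightarrow> 'v) \<Rightarrow> bool" where
  "weakly_mixing G S \<pi> \<longleftrightarrow>
     \<not> (\<exists>W. subrepresentation G S \<pi> W \<and> W \<noteq> {vzero S} \<and> finite_dimensional S W)"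


section \<open>Completion by Cauchy sequences\<close>

definition cauchy_seqs :: "('v, 'm) inner_space_scheme \<Rightarrow> (nat \<Rightarrow> 'v) set" where
  "cauchy_seqs S = {x. Metric_space.MCauchy (carrier S) (vdist S) x}"

definition cauchy_equiv :: "('v, 'm) inner_space_scheme \<Rightarrow> ((nat \<Rightarrow> 'v) \<times> (nat \<Rightarrow> 'v)) set" where
  "cauchy_equiv S = {(x, y). x \<in> cauchy_seqs S \<and> y \<in> cauchy_seqs S \<and>
     (\<lambda>n. vdist S (x n) (y n)) \<longlonglongrightarrow> 0}"

definition cauchy_class :: "('v, 'm) inner_space_scheme \<Rightarrow> (nat \<Rightarrow> 'v) \<Rightarrow> (nat \<Rightarrow> 'v) set" where
  "cauchy_class S x = cauchy_equiv S `` {x}"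

definition hilbert_completion :: "('v, 'm) inner_space_scheme \<Rightarrow> (nat \<Rightarrow> 'v) set inner_space" where
  "hilbert_completion S = \<lparr>
     carrier = cauchy_seqs S // cauchy_equiv S,
     vadd = (\<lambda>X Y. \<Union>x\<in>X. \<Union>y\<in>Y. cauchy_class S (\<lambda>n. vadd S (x n) (y n))),
     vzero = cauchy_class S (\<lambda>n. vzero S),
     vscale = (\<lambda>c X. \<Union>x\<in>X. cauchy_class S (\<lambda>n. vscale S c (x n))),
     vinner = (\<lambda>X Y. THE c. \<exists>x\<in>X. \<exists>y\<in>Y. (\<lambda>n. vinner S (x n) (y n)) \<longlonglongrightarrow> c)\<rparr>"

definition completion_map ::
    "('v, 'm) inner_space_scheme \<Rightarrow> ('v \<Rightarrow> 'v) \<Rightarrow> (nat \<Rightarrow> 'v) set \<Rightarrow> (nat \<Rightarrow> 'v) set" where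
  "completion_map S T X = (\<Union>x\<in>X. cauchy_class S (\<lambda>n. T (x n)))"


section \<open>Trees and forests\<close>

datatype tree = Leaf | Node tree tree

type_synonym forest = "tree list"

fun leaves :: "tree \<Rightarrow> nat" where
  "leaves Leaf = 1"
| "leaves (Node l r) = leaves l + leaves r"

text \<open>\<open>attach f t\<close> is \<open>f \<circ> t\<close>; it is meaningful only if \<open>length f = leaves t\<close>. Similarly for
  the composition of forests.\<close>

fun attach :: "forest \<Rightarrow> tree \<Rightarrow> tree" where
  "attach f Leaf = hd f"
| "attach f (Node l r) = Node (attach (take (leaves l) f) l) (attach (drop (leaves l) f) r)"

fun forest_comp :: "forest \<Rightarrow> forest \<Rightarrow> forest" where
  "forest_comp f [] = []"
| "forest_comp f (t # g) = attach (take (leaves t) f) t # forest_comp (drop (leaves t) f) g"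

definition forest_leaves :: "forest \<Rightarrow> nat" where
  "forest_leaves f = sum_list (map leaves f)"

text \<open>The elementary forest with \<open>n\<close> roots whose only nontrivial tree, at position \<open>k\<close>
  (counted from \<open>0\<close>), has two leaves.\<close>

definition elementary_forest :: "nat \<Rightarrow> nat \<Rightarrow> forest" where
  "elementary_forest k n = (replicate n Leaf)[k := Node Leaf Leaf]"


section \<open>Thompson's group \<open>F\<close>\<close>

definition tree_pairs :: "(tree \<times> tree) set" where
  "tree_pairs = {(t, s). leaves t = leaves s}"

inductive grow :: "tree \<times> tree \<Rightarrow> tree \<times> tree \<Rightarrow> bool" where
  "\<lbrakk>leaves t = leaves s; length f = leaves t\<rbrakk> \<Longrightarrow> grow (attach f t, attach f s) (t, s)"

definition F_equiv :: "((tree \<times> tree) \<times> (tree \<times> tree)) set" where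
  "F_equiv = {(p, q). p \<in> tree_pairs \<and> q \<in> tree_pairs \<and> equivclp grow p q}"

definition F_class :: "tree \<Rightarrow> tree \<Rightarrow> (tree \<times> tree) set" where
  "F_class t s = F_equiv `` {(t, s)}"

definition thompson_F :: "(tree \<times> tree) set monoid" where
  "thompson_F = \<lparr>
     carrier = tree_pairs // F_equiv,
     mult = (\<lambda>g h. \<Union>{F_class (attach f t) (attach f' s') | f f' t s t' s'.
       (t, s) \<in> g \<and> (t', s') \<in> h \<and> length f = leaves s \<and> length f' = leaves t' \<and>
       attach f s = attach f' t'}),
     one = F_class Leaf Leaf\<rparr>"


section \<open>The Pythagorean representation\<close>

text \<open>A vector of \<open>\<HH>\<^sub>t\<close> is the list, of length \<open>leaves t\<close>, of the decorations of the leaves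
  of \<open>t\<close> from left to right. The isometry \<open>\<Phi>(f)\<close> is given in closed form; the lemmas
  \<open>Phi_elementary\<close>, \<open>Phi_comp\<close> and \<open>Phi_unique\<close> below say that it is the unique
  multiplicative extension of its values on elementary forests.\<close>

fun Phi_tree :: "('h \<Rightarrow> 'h) \<Rightarrow> ('h \<Rightarrow> 'h) \<Rightarrow> tree \<Rightarrow> 'h \<Rightarrow> 'h list" where
  "Phi_tree A B Leaf x = [x]"
| "Phi_tree A B (Node l r) x = Phi_tree A B l (A x) @ Phi_tree A B r (B x)"

definition Phi :: "('h \<Rightarrow> 'h) \<Rightarrow> ('h \<Rightarrow> 'h) \<Rightarrow> forest \<Rightarrow> 'h list \<Rightarrow> 'h list" where
  "Phi A B f \<xi> = concat (map2 (Phi_tree A B) f \<xi>)"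

definition decorated_trees :: "(tree \<times> 'h list) set" where
  "decorated_trees = {(t, \<xi>). length \<xi> = leaves t}"

definition limit_equiv ::
    "('h \<Rightarrow> 'h) \<Rightarrow> ('h \<Rightarrow> 'h) \<Rightarrow> ((tree \<times> 'h list) \<times> (tree \<times> 'h list)) set" where
  "limit_equiv A B = {((t, \<xi>), (s, \<eta>)).
     (t, \<xi>) \<in> decorated_trees \<and> (s, \<eta>) \<in> decorated_trees \<and>
     (\<exists>f g. length f = leaves t \<and> length g = leaves s \<and> attach f t = attach g s \<and>
        Phi A B f \<xi> = Phi A B g \<eta>)}"

definition limit_class ::
    "('h \<Rightarrow> 'h) \<Rightarrow> ('h \<Rightarrow> 'h) \<Rightarrow> tree \<Rightarrow> 'h list \<Rightarrow> (tree \<times> 'h list) set" where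
  "limit_class A B t \<xi> = limit_equiv A B `` {(t, \<xi>)}"

text \<open>The direct limit \<open>\<K>\<close>: by directedness, any two elements have representatives with a
  common tree, on which the operations are those of \<open>\<HH>\<^sub>t\<close>.\<close>

definition direct_limit ::
    "('h::complex_inner \<Rightarrow> 'h) \<Rightarrow> ('h \<Rightarrow> 'h) \<Rightarrow> (tree \<times> 'h list) set inner_space" where
  "direct_limit A B = \<lparr>
     carrier = decorated_trees // limit_equiv A B,
     vadd = (\<lambda>X Y. \<Union>{limit_class A B t (map2 (+) \<xi> \<eta>) | t \<xi> \<eta>. (t, \<xi>) \<in> X \<and> (t, \<eta>) \<in> Y}),
     vzero = limit_class A B Leaf [0],
     vscale = (\<lambda>c X. \<Union>{limit_class A B t (map (scaleC c) \<xi>) | t \<xi>. (t, \<xi>) \<in> X}),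
     vinner = (\<lambda>X Y. THE c. \<exists>t \<xi> \<eta>. (t, \<xi>) \<in> X \<and> (t, \<eta>) \<in> Y \<and>
       c = sum_list (map2 cinner \<xi> \<eta>))\<rparr>"

text \<open>The action is \<open>[t, s] \<cdot> [s, \<xi>] = [t, \<xi>]\<close>, see \<open>limit_rep_class\<close> below; on the completion it is
  extended termwise to Cauchy sequences.\<close>

definition limit_rep ::
    "('h \<Rightarrow> 'h) \<Rightarrow> ('h \<Rightarrow> 'h) \<Rightarrow> (tree \<times> tree) set \<Rightarrow>
     (tree \<times> 'h list) set \<Rightarrow> (tree \<times> 'h list) set" where
  "limit_rep A B g X = \<Union>{limit_class A B t \<xi> | t s \<xi>. (t, s) \<in> g \<and> (s, \<xi>) \<in> X}"

definition pyth_space ::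
    "('h::complex_inner \<Rightarrow> 'h) \<Rightarrow> ('h \<Rightarrow> 'h) \<Rightarrow> (nat \<Rightarrow> (tree \<times> 'h list) set) set inner_space" where
  "pyth_space A B = hilbert_completion (direct_limit A B)"

definition pyth_rep ::
    "('h::complex_inner \<Rightarrow> 'h) \<Rightarrow> ('h \<Rightarrow> 'h) \<Rightarrow> (tree \<times> tree) set \<Rightarrow>
     (nat \<Rightarrow> (tree \<times> 'h list) set) set \<Rightarrow> (nat \<Rightarrow> (tree \<times> 'h list) set) set" where
  "pyth_rep A B g = completion_map (direct_limit A B) (limit_rep A B g)"


section \<open>Well-definedness\<close>

text \<open>The main results are \<open>cadjoint\<close>, \<open>group_thompson_F\<close>, \<open>complex_inner_space_direct_limit\<close>,
  \<open>hilbert_space_pyth_space\<close>, \<open>unitary_representation_pyth_rep\<close> and \<open>pyth_rep_class\<close>.\<close>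

subsection \<open>Forests\<close>

lemma leaves_pos: "0 < leaves t"
  by (induction t) auto

lemma forest_leaves_simps [simp]:
  "forest_leaves [] = 0" "forest_leaves (t # f) = leaves t + forest_leaves f"
  "forest_leaves (f @ g) = forest_leaves f + forest_leaves g"
  by (auto simp: forest_leaves_def)

lemma length_le_forest_leaves: "length f \<le> forest_leaves f"
proof (induction f)
  case (Cons t f)
  then show ?case using leaves_pos[of t] by simp
qed simp

lemma leaves_attach: "length f = leaves t \<Longrightarrow> leaves (attach f t) = forest_leaves f"
proof (induction t arbitrary: f)
  case Leaf
  then show ?case by (cases f) auto
next
  case (Node l r)
  have "forest_leaves f = forest_leaves (take (leaves l) f) + forest_leaves (drop (leaves l) f)"
    by (metis append_take_drop_id forest_leaves_simps(3))
  with Node show ?case by auto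
qed

lemma length_forest_comp [simp]: "length (forest_comp f g) = length g"
  by (induction f g rule: forest_comp.induct) auto

lemma forest_leaves_comp:
  "length f = forest_leaves g \<Longrightarrow> forest_leaves (forest_comp f g) = forest_leaves f"
proof (induction g arbitrary: f)
  case (Cons t g)
  have "forest_leaves f = forest_leaves (take (leaves t) f) + forest_leaves (drop (leaves t) f)"
    by (metis append_take_drop_id forest_leaves_simps(3))
  with Cons show ?case by (auto simp: leaves_attach)
qed auto

lemma forest_comp_append:
  "forest_comp f (g @ h) =
     forest_comp (take (forest_leaves g) f) g @ forest_comp (drop (forest_leaves g) f) h"
  by (induction g arbitrary: f) (auto simp: take_drop add.commute min_def)

lemma attach_attach:
  "\<lbrakk>length g = leaves t; length f = forest_leaves g\<rbrakk> \<Longrightarrow>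
     attach f (attach g t) = attach (forest_comp f g) t"
proof (induction t arbitrary: f g)
  case Leaf
  then show ?case by (cases g) auto
next
  case (Node l r)
  define g1 g2 where "g1 = take (leaves l) g" "g2 = drop (leaves l) g"
  have g: "g = g1 @ g2" "length g1 = leaves l" "length g2 = leaves r"
    using Node.prems by (auto simp: g1_g2_def)
  with Node.prems have "length f = forest_leaves g1 + forest_leaves g2" by simp
  with Node.IH g show ?case
    by (simp add: leaves_attach forest_comp_append)
qed

lemma attach_inject:
  "\<lbrakk>length f = leaves t; length g = leaves t; attach f t = attach g t\<rbrakk> \<Longrightarrow> f = g"
proof (induction t arbitrary: f g)
  case Leaf
  then show ?case by (cases f; cases g) auto
next
  case (Node l r)
  then have "take (leaves l) f = take (leaves l) g" "drop (leaves l) f = drop (leaves l) g"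
    by auto
  then show ?case by (metis append_take_drop_id)
qed

lemma attach_right_inject:
  "\<lbrakk>length f = leaves t; length f = leaves s; attach f t = attach f s\<rbrakk> \<Longrightarrow> t = s"
proof (induction t arbitrary: f s)
  case Leaf
  then show ?case
  proof (cases s)
    case (Node l r)
    with Leaf leaves_pos[of l] leaves_pos[of r] show ?thesis by simp
  qed auto
next
  case (Node l r)
  show ?case
  proof (cases s)
    case Leaf
    with Node leaves_pos[of l] leaves_pos[of r] show ?thesis by simp
  next
    case s: (Node l' r')
    have eq: "attach (take (leaves l) f) l = attach (take (leaves l') f) l'"
        "attach (drop (leaves l) f) r = attach (drop (leaves l') f) r'"
      using Node.prems s by auto
    have len: "leaves l \<le> length f" "leaves l' \<le> length f" using Node.prems s by auto
    have mono: "forest_leaves (take i f) < forest_leaves (take j f)"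
      if "i < j" "j \<le> length f" for i j
    proof -
      have "take j f = take i f @ take (j - i) (drop i f)"
        using that by (metis le_add_diff_inverse less_imp_le take_add)
      moreover have "0 < length (take (j - i) (drop i f))" using that by simp
      ultimately show ?thesis
        using length_le_forest_leaves[of "take (j - i) (drop i f)"]
        by (metis forest_leaves_simps(3) less_add_same_cancel1 less_le_trans)
    qed
    have "forest_leaves (take (leaves l) f) = forest_leaves (take (leaves l') f)"
      using eq(1) len by (metis leaves_attach length_take min_absorb2)
    then have "leaves l = leaves l'"
      using mono len by (metis less_irrefl linorder_neqE_nat)
    with eq Node.IH(1)[of "take (leaves l) f" l'] Node.IH(2)[of "drop (leaves l) f" r'] Node.prems s
    show ?thesis by auto
  qed
qed

lemma common_refinement:
  "\<exists>f g. length f = leaves t \<and> length g = leaves s \<and> attach f t = attach g s"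
proof (induction t arbitrary: s)
  case Leaf
  have "attach (replicate (leaves s) Leaf) s = s"
    by (induction s) (auto simp: replicate_add)
  then show ?case
    by (intro exI[of _ "[s]"] exI[of _ "replicate (leaves s) Leaf"]) auto
next
  case (Node l r)
  show ?case
  proof (cases s)
    case Leaf
    have "attach (replicate (leaves t) Leaf) t = t" for t
      by (induction t) (auto simp: replicate_add)
    with Leaf show ?thesis
      by (intro exI[of _ "replicate (leaves (Node l r)) Leaf"] exI[of _ "[Node l r]"])
         (auto simp: replicate_add)
  next
    case s: (Node l' r')
    obtain f g where "length f = leaves l" "length g = leaves l'" "attach f l = attach g l'"
      using Node.IH(1) by blast
    moreover obtain f' g' where
        "length f' = leaves r" "length g' = leaves r'" "attach f' r = attach g' r'"
      using Node.IH(2) by blast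
    ultimately show ?thesis using s
      by (intro exI[of _ "f @ f'"] exI[of _ "g @ g'"]) auto
  qed
qed

lemma attach_trivial [simp]: "attach (replicate (leaves t) Leaf) t = t"
  by (induction t) (auto simp: replicate_add)

lemma forest_leaves_trivial [simp]: "forest_leaves (replicate n Leaf) = n"
  by (simp add: forest_leaves_def map_replicate_const sum_list_replicate)

subsection \<open>The functor\<close>

lemma length_Phi_tree [simp]: "length (Phi_tree A B t x) = leaves t"
  by (induction t arbitrary: x) auto

lemma Phi_simps [simp]:
  "Phi A B [] [] = []" "Phi A B (t # f) (x # \<xi>) = Phi_tree A B t x @ Phi A B f \<xi>"
  by (auto simp: Phi_def)

lemma Phi_append:
  "length f = length \<xi> \<Longrightarrow> Phi A B (f @ g) (\<xi> @ \<eta>) = Phi A B f \<xi> @ Phi A B g \<eta>"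
  by (simp add: Phi_def)

lemma length_Phi [simp]: "length \<xi> = length f \<Longrightarrow> length (Phi A B f \<xi>) = forest_leaves f"
  by (induction \<xi> f rule: list_induct2) auto

lemma Phi_trivial [simp]: "length \<xi> = n \<Longrightarrow> Phi A B (replicate n Leaf) \<xi> = \<xi>"
  by (induction n arbitrary: \<xi>) (auto simp: length_Suc_conv)

lemma elementary_forest_eq: "k < n \<Longrightarrow>
    elementary_forest k n = replicate k Leaf @ Node Leaf Leaf # replicate (n - Suc k) Leaf"
  by (simp add: elementary_forest_def upd_conv_take_nth_drop min_def)

lemma Phi_elementary:
  assumes "length \<xi> = n" "k < n"
  shows "Phi A B (elementary_forest k n) \<xi> =
    take k \<xi> @ [A (\<xi> ! k), B (\<xi> ! k)] @ drop (Suc k) \<xi>"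
proof -
  have "\<xi> = take k \<xi> @ \<xi> ! k # drop (Suc k) \<xi>"
    using assms by (simp add: id_take_nth_drop)
  then have "Phi A B (elementary_forest k n) \<xi> =
      Phi A B (elementary_forest k n) (take k \<xi> @ \<xi> ! k # drop (Suc k) \<xi>)"
    by simp
  also have "\<dots> = take k \<xi> @ [A (\<xi> ! k), B (\<xi> ! k)] @ drop (Suc k) \<xi>"
    using assms by (simp add: Phi_append elementary_forest_eq)
  finally show ?thesis .
qed

lemma Phi_attach:
  "length f = leaves t \<Longrightarrow> Phi_tree A B (attach f t) x = Phi A B f (Phi_tree A B t x)"
proof (induction t arbitrary: f x)
  case Leaf
  then show ?case by (cases f) auto
next
  case (Node l r)
  have "Phi A B f (Phi_tree A B (Node l r) x) =
      Phi A B (take (leaves l) f @ drop (leaves l) f) (Phi_tree A B l (A x) @ Phi_tree A B r (B x))"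
    by simp
  also have "\<dots> = Phi A B (take (leaves l) f) (Phi_tree A B l (A x)) @
      Phi A B (drop (leaves l) f) (Phi_tree A B r (B x))"
    using Node.prems by (subst Phi_append) auto
  finally show ?case using Node by simp
qed

lemma Phi_comp:
  "\<lbrakk>length \<xi> = length g; length f = forest_leaves g\<rbrakk> \<Longrightarrow>
     Phi A B (forest_comp f g) \<xi> = Phi A B f (Phi A B g \<xi>)"
proof (induction \<xi> g arbitrary: f rule: list_induct2)
  case (Cons x \<xi> t g)
  have "Phi A B f (Phi A B (t # g) (x # \<xi>)) =
      Phi A B (take (leaves t) f @ drop (leaves t) f) (Phi_tree A B t x @ Phi A B g \<xi>)"
    by simp
  also have "\<dots> = Phi A B (take (leaves t) f) (Phi_tree A B t x) @
      Phi A B (drop (leaves t) f) (Phi A B g \<xi>)"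
    using Cons by (subst Phi_append) auto
  finally show ?case using Cons by (simp add: Phi_attach)
qed auto

lemma forest_comp_trivial: "length f = n \<Longrightarrow> forest_comp f (replicate n Leaf) = f"
  by (induction n arbitrary: f) (auto simp: length_Suc_conv)

lemma Phi_unique:
  assumes triv: "\<And>n \<xi>. length \<xi> = n \<Longrightarrow> \<Psi> (replicate n Leaf) \<xi> = \<xi>"
    and elem: "\<And>k n \<xi>. \<lbrakk>length \<xi> = n; k < n\<rbrakk> \<Longrightarrow> \<Psi> (elementary_forest k n) \<xi> =
      take k \<xi> @ [A (\<xi> ! k), B (\<xi> ! k)] @ drop (Suc k) \<xi>"
    and comp: "\<And>f g \<xi>. \<lbrakk>length \<xi> = length g; length f = forest_leaves g\<rbrakk> \<Longrightarrow>
      \<Psi> (forest_comp f g) \<xi> = \<Psi> f (\<Psi> g \<xi>)"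
    and "length \<xi> = length f"
  shows "\<Psi> f \<xi> = Phi A B f \<xi>"
  using \<open>length \<xi> = length f\<close>
proof (induction "forest_leaves f - length f" arbitrary: f \<xi> rule: less_induct)
  case less
  show ?case
  proof (cases "\<forall>t\<in>set f. t = Leaf")
    case True
    then have "f = replicate (length f) Leaf" by (simp add: replicate_eqI)
    then show ?thesis using less.prems triv Phi_trivial by metis
  next
    case False
    then obtain t where "t \<in> set f" "t \<noteq> Leaf" by blast
    then obtain l r where "Node l r \<in> set f" by (metis tree.exhaust)
    then obtain u v where f: "f = u @ Node l r # v" by (meson split_list)
    define g where "g = elementary_forest (length u) (length f)"
    define f' where "f' = u @ l # r # v"
    have g: "g = replicate (length u) Leaf @ Node Leaf Leaf # replicate (length v) Leaf"
      by (simp add: g_def f elementary_forest_eq)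
    have fg: "f = forest_comp f' g"
      by (simp add: g f f'_def forest_comp_append forest_comp_trivial)
    have len: "length f' = forest_leaves g" "length g = length f"
      by (simp_all add: g f f'_def)
    have "forest_leaves f' - length f' < forest_leaves f - length f"
      using length_le_forest_leaves[of f'] by (simp add: f f'_def)
    moreover have "length (Phi A B g \<xi>) = length f'"
      using less.prems len by simp
    ultimately have "\<Psi> f' (Phi A B g \<xi>) = Phi A B f' (Phi A B g \<xi>)"
      using less.hyps by blast
    moreover have "\<Psi> g \<xi> = Phi A B g \<xi>"
      unfolding g_def using less.prems by (simp add: elem Phi_elementary f)
    ultimately show ?thesis
      using comp[of \<xi> g f'] Phi_comp[of \<xi> g f' A B] less.prems len by (simp flip: fg)
  qed
qed

subsection \<open>Adjoints\<close>

lemma scaleC_one [simp]: "1 *\<^sub>C (x::'a::complex_inner) = x"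
  using scaleR_scaleC[of 1 x] by simp

lemma scaleC_minus_one: "(- 1) *\<^sub>C (x::'a::complex_inner) = - x"
  using scaleR_scaleC[of "- 1" x] by simp

lemma cinner_add_left: "cinner (x + y) (z::'a::complex_inner) = cinner x z + cinner y z"
  by (metis cinner_add_right cinner_commute complex_cnj_add)

lemma cinner_scaleC_left: "cinner (c *\<^sub>C x) (y::'a::complex_inner) = cnj c * cinner x y"
  by (metis cinner_commute cinner_scaleC_right complex_cnj_mult)

lemma cinner_zero [simp]: "cinner (x::'a::complex_inner) 0 = 0" "cinner 0 (x::'a::complex_inner) = 0"
  using cinner_add_right[of x 0 0] cinner_add_left[of 0 0 x] by simp_all

lemma norm_add_cinner:
  "(norm (x + y::'a::complex_inner))\<^sup>2 = (norm x)\<^sup>2 + (norm y)\<^sup>2 + 2 * Re (cinner x y)"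
proof -
  have "complex_of_real ((norm (x + y))\<^sup>2) =
      complex_of_real ((norm x)\<^sup>2) + complex_of_real ((norm y)\<^sup>2) + (cinner x y + cnj (cinner x y))"
    unfolding cinner_self[symmetric]
    by (simp add: cinner_add_left cinner_add_right cinner_commute[of y x])
  also have "cinner x y + cnj (cinner x y) = complex_of_real (2 * Re (cinner x y))"
    by (simp add: complex_add_cnj)
  finally show ?thesis by (metis of_real_add of_real_eq_iff)
qed

lemma norm_scaleC: "norm (c *\<^sub>C (x::'a::complex_inner)) = cmod c * norm x"
proof -
  have "complex_of_real ((norm (c *\<^sub>C x))\<^sup>2) = complex_of_real ((cmod c * norm x)\<^sup>2)"
    using complex_norm_square[of c]
    by (simp only: cinner_self[symmetric, of "c *\<^sub>C x"] power_mult_distrib of_real_mult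
        cinner_scaleC_left cinner_scaleC_right cinner_self[of x] mult.assoc mult.left_commute)
  then have "(norm (c *\<^sub>C x))\<^sup>2 = (cmod c * norm x)\<^sup>2" by (simp only: of_real_eq_iff)
  then show ?thesis by (simp add: power2_eq_iff_nonneg)
qed

lemma Re_cinner_le: "Re (cinner x (y::'a::complex_inner)) \<le> norm x * norm y"
proof -
  have "(norm (x + y))\<^sup>2 \<le> (norm x + norm y)\<^sup>2"
    by (simp add: norm_triangle_ineq power_mono)
  then show ?thesis unfolding norm_add_cinner by (simp add: power2_sum)
qed

lemma cmod_cinner_le: "cmod (cinner x (y::'a::complex_inner)) \<le> norm x * norm y"
proof (cases "cinner x y = 0")
  case False
  define c where "c = cnj (cinner x y) / cmod (cinner x y)"
  have "cmod c = 1" using False by (simp add: c_def norm_divide)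
  moreover have "c * cinner x y = cmod (cinner x y)"
    using False complex_norm_square[of "cinner x y"]
    by (simp add: c_def field_simps power2_eq_square)
  ultimately show ?thesis
    using Re_cinner_le[of x "c *\<^sub>C y"] by (simp add: cinner_scaleC_right norm_scaleC)
qed simp

lemma riesz_representation:
  fixes \<phi> :: "'a::chilbert_space \<Rightarrow> complex"
  assumes add: "\<And>x y. \<phi> (x + y) = \<phi> x + \<phi> y" and scale: "\<And>c x. \<phi> (c *\<^sub>C x) = c * \<phi> x"
    and bound: "\<And>x. cmod (\<phi> x) \<le> K * norm x"
  shows "\<exists>z. \<forall>x. cinner z x = \<phi> x"
proof -
  define J where "J x = (norm x)\<^sup>2 - 2 * Re (\<phi> x)" for x
  have J_ge: "J x \<ge> - K\<^sup>2" for x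
  proof -
    have "Re (\<phi> x) \<le> K * norm x"
      using complex_Re_le_cmod[of "\<phi> x"] bound[of x] by linarith
    moreover have "0 \<le> (norm x - K)\<^sup>2" by simp
    ultimately show ?thesis by (simp add: J_def power2_diff algebra_simps)
  qed
  define m where "m = (INF x. J x)"
  have bdd: "bdd_below (range J)" using J_ge by (intro bdd_belowI[of _ "- K\<^sup>2"]) auto
  then have m_le: "m \<le> J x" for x by (simp add: m_def cINF_lower)
  have lin: "linear (\<lambda>x. Re (\<phi> x))"
    by (rule linearI) (simp_all add: add scale scaleR_scaleC)
  have blin: "bounded_linear (\<lambda>x. Re (\<phi> x))"
  proof (rule bounded_linear_intro[where K = K])
    show "norm (Re (\<phi> x)) \<le> norm x * K" for x
      using abs_Re_le_cmod[of "\<phi> x"] bound[of x] by (simp add: mult.commute)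
  qed (simp_all add: add scale scaleR_scaleC)
  have par: "(norm (a - b))\<^sup>2 \<le> 2 * (J a - m) + 2 * (J b - m)" for a b
  proof -
    have "Re (\<phi> ((1/2) *\<^sub>R (a + b))) = (Re (\<phi> a) + Re (\<phi> b)) / 2"
      using linear_cmul[OF lin, of "1/2" "a + b"] linear_add[OF lin, of a b]
      by (simp add: add_divide_distrib del: scaleR_add_right)
    moreover have "(norm ((1/2) *\<^sub>R (a + b)))\<^sup>2 = (norm (a + b))\<^sup>2 / 4"
      by (simp add: power_divide)
    moreover have "(norm (a - b))\<^sup>2 = 2 * (norm a)\<^sup>2 + 2 * (norm b)\<^sup>2 - (norm (a + b))\<^sup>2"
    proof -
      have "cinner a (- b) = - cinner a b"
        using cinner_scaleC_right[of a "- 1" b] unfolding scaleC_minus_one by simp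
      then show ?thesis using norm_add_cinner[of a b] norm_add_cinner[of a "- b"] by simp
    qed
    ultimately show ?thesis
      using m_le[of "(1/2) *\<^sub>R (a + b)"] by (simp add: J_def)
  qed
  have "\<exists>x. J x < m + inverse (real (Suc n))" for n
    using cINF_less_iff[OF _ bdd, of "m + inverse (real (Suc n))"] by (simp add: m_def)
  then obtain x where x: "J (x n) < m + inverse (real (Suc n))" for n by metis
  have "Cauchy x"
  proof (rule metric_CauchyI)
    fix e :: real assume "0 < e"
    then obtain N where N: "inverse (real (Suc N)) < e\<^sup>2 / 4"
      using reals_Archimedean[of "e\<^sup>2 / 4"] by auto
    define q where "q = inverse (real (Suc N))"
    have q: "2 * q + 2 * q < e\<^sup>2" using N by (simp add: q_def)
    have *: "J (x k) < m + q" if "k \<ge> N" for k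
      unfolding q_def by (rule less_le_trans[OF x]) (use that in simp)
    show "\<exists>M. \<forall>a\<ge>M. \<forall>b\<ge>M. dist (x a) (x b) < e"
    proof (intro exI allI impI)
      fix a b assume "N \<le> a" "N \<le> b"
      then have "J (x a) < m + q" "J (x b) < m + q" using * by auto
      then have "(norm (x a - x b))\<^sup>2 < e\<^sup>2" using par[of "x a" "x b"] q by argo
      then show "dist (x a) (x b) < e"
        unfolding dist_norm using \<open>0 < e\<close> power2_less_imp_less less_imp_le by metis
    qed
  qed
  then obtain z where z: "x \<longlonglongrightarrow> z" unfolding Cauchy_convergent_iff convergent_def ..
  have "(\<lambda>n. J (x n)) \<longlonglongrightarrow> J z"
    unfolding J_def
    by (intro tendsto_diff tendsto_power tendsto_norm tendsto_mult tendsto_const z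
        bounded_linear.tendsto[OF blin])
  moreover have "(\<lambda>n. m + inverse (real (Suc n))) \<longlonglongrightarrow> m + 0"
    by (intro tendsto_add tendsto_const LIMSEQ_inverse_real_of_nat)
  ultimately have "J z \<le> m + 0"
    by (rule LIMSEQ_le) (use x less_imp_le in blast)
  then have min: "J z \<le> J y" for y using m_le[of y] by simp
  have Re_eq: "Re (cinner z y) = Re (\<phi> y)" for y
  proof (rule ccontr)
    assume ne: "Re (cinner z y) \<noteq> Re (\<phi> y)"
    define d where "d = Re (cinner z y) - Re (\<phi> y)"
    have *: "0 \<le> t\<^sup>2 * (norm y)\<^sup>2 + 2 * t * d" for t
    proof -
      have "J (z + t *\<^sub>R y) = J z + t\<^sup>2 * (norm y)\<^sup>2 + 2 * t * d"
      proof -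
        have "cinner z (t *\<^sub>R y) = t * cinner z y" by (simp only: scaleR_scaleC cinner_scaleC_right)
        then have "(norm (z + t *\<^sub>R y))\<^sup>2 = (norm z)\<^sup>2 + t\<^sup>2 * (norm y)\<^sup>2 + 2 * (t * Re (cinner z y))"
          by (simp add: norm_add_cinner power_mult_distrib)
        moreover have "Re (\<phi> (z + t *\<^sub>R y)) = Re (\<phi> z) + t * Re (\<phi> y)"
          using linear_add[OF lin, of z "t *\<^sub>R y"] linear_cmul[OF lin, of t y] by simp
        ultimately show ?thesis by (simp add: J_def d_def algebra_simps)
      qed
      then show ?thesis using min[of "z + t *\<^sub>R y"] by simp
    qed
    define t where "t = - d / ((norm y)\<^sup>2 + 1)"
    have "t\<^sup>2 * (norm y)\<^sup>2 \<le> t\<^sup>2 * ((norm y)\<^sup>2 + 1)" by (simp add: mult_left_mono)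
    also have "\<dots> = t * (t * ((norm y)\<^sup>2 + 1))" by (simp add: power2_eq_square mult.assoc)
    also have "t * ((norm y)\<^sup>2 + 1) = - d"
    proof -
      have "(norm y)\<^sup>2 + 1 \<noteq> 0" using zero_le_power2[of "norm y"] by linarith
      then show ?thesis by (simp add: t_def)
    qed
    finally have "0 \<le> t * d" using *[of t] by simp
    moreover have "t * d = - (d\<^sup>2 / ((norm y)\<^sup>2 + 1))" by (simp add: t_def power2_eq_square)
    moreover have "d\<^sup>2 / ((norm y)\<^sup>2 + 1) > 0"
      using ne by (simp add: d_def add_nonneg_pos)
    ultimately show False by simp
  qed
  have "cinner z y = \<phi> y" for y
  proof (rule complex_eqI[OF Re_eq])
    show "Im (cinner z y) = Im (\<phi> y)"
      using Re_eq[of "\<i> *\<^sub>C y"] by (simp add: cinner_scaleC_right scale)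
  qed
  then show ?thesis by blast
qed

lemma cadjoint:
  fixes T :: "'a::chilbert_space \<Rightarrow> 'b::complex_inner"
  assumes "bounded_clinear T"
  shows "cinner (cadjoint T y) x = cinner y (T x)"
proof -
  obtain K where K: "norm (T x) \<le> K * norm x" for x
    using assms unfolding bounded_clinear_def by blast
  have "\<exists>z. \<forall>x. cinner z x = cinner y (T x)" for y
  proof (rule riesz_representation[where K = "norm y * K"])
    show "cmod (cinner y (T x)) \<le> norm y * K * norm x" for x
      using cmod_cinner_le[of y "T x"] mult_left_mono[OF K[of x] norm_ge_zero[of y]]
      by (simp add: mult.assoc)
  qed (use assms in \<open>auto simp: bounded_clinear_def cinner_add_right cinner_scaleC_right\<close>)
  then have "\<exists>T'. \<forall>x y. cinner (T' y) x = cinner y (T x)" by metis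
  from someI_ex[OF this] show ?thesis unfolding cadjoint_def by blast
qed

lemma pythagorean_pair_cinner:
  assumes "pythagorean_pair A B"
  shows "cinner (A x) (A y) + cinner (B x) (B y) = cinner x y"
proof -
  have "cinner (cadjoint A (A x) + cadjoint B (B x)) y = cinner x y"
    using assms by (metis pythagorean_pair_def id_apply)
  then show ?thesis
    using assms by (simp add: cinner_add_left cadjoint pythagorean_pair_def)
qed

subsection \<open>The group \<open>F\<close>\<close>

lemma attach_amalgam:
  assumes "length f = leaves t" "length g = leaves t"
  obtains p q where "length p = forest_leaves f" "length q = forest_leaves g"
    "forest_comp p f = forest_comp q g"
proof -
  obtain p q where pq: "length p = leaves (attach f t)" "length q = leaves (attach g t)"
      "attach p (attach f t) = attach q (attach g t)"
    using common_refinement by blast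
  then have "attach (forest_comp p f) t = attach (forest_comp q g) t"
    using assms by (simp add: leaves_attach attach_attach)
  then have "forest_comp p f = forest_comp q g"
    using assms by (intro attach_inject[of _ t]) auto
  then show ?thesis using that pq assms by (simp add: leaves_attach)
qed

lemma leaves_attach_eq:
  "\<lbrakk>length f = leaves t; leaves t = leaves s\<rbrakk> \<Longrightarrow> leaves (attach f t) = leaves (attach f s)"
  by (simp add: leaves_attach)

definition F_rel :: "tree \<Rightarrow> tree \<Rightarrow> tree \<Rightarrow> tree \<Rightarrow> bool" where
  "F_rel t s t' s' \<longleftrightarrow> leaves t = leaves s \<and> leaves t' = leaves s' \<and>
     (\<exists>f g. length f = leaves t \<and> length g = leaves t' \<and>
       attach f t = attach g t' \<and> attach f s = attach g s')"

lemma F_rel_refl: "leaves t = leaves s \<Longrightarrow> F_rel t s t s"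
  unfolding F_rel_def by (metis length_replicate)

lemma F_rel_sym: "F_rel t s t' s' \<Longrightarrow> F_rel t' s' t s"
  unfolding F_rel_def by metis

lemma F_rel_trans:
  assumes "F_rel t s t' s'" "F_rel t' s' t'' s''"
  shows "F_rel t s t'' s''"
proof -
  obtain f g where fg: "length f = leaves t" "length g = leaves t'"
      "attach f t = attach g t'" "attach f s = attach g s'"
    using assms(1) unfolding F_rel_def by blast
  obtain h k where hk: "length h = leaves t'" "length k = leaves t''"
      "attach h t' = attach k t''" "attach h s' = attach k s''"
    using assms(2) unfolding F_rel_def by blast
  obtain p q where pq: "length p = forest_leaves g" "length q = forest_leaves h"
      "forest_comp p g = forest_comp q h"
    using attach_amalgam[OF fg(2) hk(1)] by blast
  have lv: "leaves t = leaves s" "leaves t' = leaves s'" "leaves t'' = leaves s''"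
    using assms by (auto simp: F_rel_def)
  have len: "forest_leaves f = forest_leaves g" "forest_leaves h = forest_leaves k"
    using fg hk leaves_attach by metis+
  have "attach (forest_comp p f) t = attach (forest_comp q k) t''"
    using fg hk pq len lv by (metis attach_attach)
  moreover have "attach (forest_comp p f) s = attach (forest_comp q k) s''"
    using fg hk pq len lv by (metis attach_attach)
  ultimately show ?thesis unfolding F_rel_def using lv fg hk
    by (metis length_forest_comp)
qed

lemma F_rel_attach:
  assumes "leaves t = leaves s" "length f = leaves t"
  shows "F_rel (attach f t) (attach f s) t s"
proof -
  have eq: "leaves (attach f t) = leaves (attach f s)" using assms leaves_attach_eq[of f t s] by simp
  define g where "g = replicate (leaves (attach f t)) Leaf"
  have "attach g (attach f t) = attach f t" "attach g (attach f s) = attach f s"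
    by (simp add: g_def) (simp add: g_def eq)
  moreover have "length g = leaves (attach f t)" by (simp add: g_def)
  ultimately show ?thesis unfolding F_rel_def using assms eq by blast
qed

lemma F_equiv_iff: "((t, s), (t', s')) \<in> F_equiv \<longleftrightarrow> F_rel t s t' s'"
proof
  assume "F_rel t s t' s'"
  then obtain f g where fg: "leaves t = leaves s" "leaves t' = leaves s'" "length f = leaves t"
      "length g = leaves t'" "attach f t = attach g t'" "attach f s = attach g s'"
    unfolding F_rel_def by blast
  have "equivclp grow (attach f t, attach f s) (t, s)"
    using grow.intros[OF fg(1,3)] by blast
  moreover have "equivclp grow (attach g t', attach g s') (t', s')"
    using grow.intros[OF fg(2,4)] by blast
  ultimately have "equivclp grow (t, s) (t', s')"
    using fg by (metis equivclp_sym equivclp_trans)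
  with fg show "((t, s), (t', s')) \<in> F_equiv" by (simp add: F_equiv_def tree_pairs_def)
next
  assume *: "((t, s), (t', s')) \<in> F_equiv"
  have "F_rel (fst p) (snd p) (fst q) (snd q)"
    if "equivclp grow p q" "p \<in> tree_pairs" for p q
    using that
  proof (induction rule: equivclp_induct)
    case base
    then show ?case by (auto simp: tree_pairs_def intro: F_rel_refl)
  next
    case (step y z)
    have "F_rel (fst y) (snd y) (fst z) (snd z)"
      using step.hyps(2) by (auto elim!: grow.cases simp: F_rel_attach F_rel_sym)
    with step show ?case by (blast intro: F_rel_trans)
  qed
  from this[of "(t, s)" "(t', s')"] * show "F_rel t s t' s'" by (simp add: F_equiv_def)
qed

lemma mem_F_class: "(t', s') \<in> F_class t s \<longleftrightarrow> F_rel t s t' s'"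
  by (simp add: F_class_def F_equiv_iff)

lemma F_class_eq: "F_rel t s t' s' \<Longrightarrow> F_class t s = F_class t' s'"
proof -
  assume *: "F_rel t s t' s'"
  have "(a, b) \<in> F_class t s \<longleftrightarrow> (a, b) \<in> F_class t' s'" for a b
    unfolding mem_F_class using * F_rel_trans F_rel_sym by meson
  then show ?thesis by auto
qed

lemma F_class_closed: "leaves t = leaves s \<Longrightarrow> F_class t s \<in> carrier thompson_F"
  by (auto simp: thompson_F_def F_class_def tree_pairs_def quotient_def)

lemma F_class_attach:
  "\<lbrakk>leaves t = leaves s; length f = leaves t\<rbrakk> \<Longrightarrow> F_class (attach f t) (attach f s) = F_class t s"
  by (intro F_class_eq F_rel_attach)

lemma F_carrierE:
  assumes "g \<in> carrier thompson_F"
  obtains t s where "leaves t = leaves s" "g = F_class t s"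
  using assms by (auto simp: thompson_F_def F_class_def tree_pairs_def quotient_def)

lemma F_classD:
  assumes "leaves t = leaves s" "(t', s') \<in> F_class t s"
  shows "leaves t' = leaves s'" "F_class t' s' = F_class t s"
  using assms F_class_eq by (auto simp: mem_F_class F_rel_def)

lemma F_class_right_inject:
  assumes "F_class t s = F_class t' s" "leaves t = leaves s" "leaves t' = leaves s"
  shows "t = t'"
proof -
  have "F_rel t s t' s" using assms by (metis F_rel_refl mem_F_class)
  then obtain f g where fg: "length f = leaves t" "length g = leaves t'"
      "attach f t = attach g t'" "attach f s = attach g s"
    unfolding F_rel_def by blast
  then have "f = g" using assms by (intro attach_inject[of f s g]) auto
  with fg have "length f = leaves t" "length f = leaves t'" "attach f t = attach f t'" by simp_all
  then show ?thesis by (rule attach_right_inject)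
qed

lemma F_mult_unique:
  assumes "leaves t = leaves m" "leaves m = leaves r" "leaves t' = leaves m'" "leaves m' = leaves r'"
    and "F_class t m = F_class t' m'" "F_class m r = F_class m' r'"
  shows "F_class t r = F_class t' r'"
proof -
  obtain p q where pq: "length p = leaves m" "length q = leaves m'" "attach p m = attach q m'"
    using common_refinement by blast
  have "attach p t = attach q t'"
  proof (rule F_class_right_inject)
    show "F_class (attach p t) (attach p m) = F_class (attach q t') (attach p m)"
      using assms pq by (metis F_class_attach)
    show "leaves (attach p t) = leaves (attach p m)" "leaves (attach q t') = leaves (attach p m)"
      using assms pq leaves_attach_eq by metis+
  qed
  moreover have "attach p r = attach q r'"
  proof (rule F_class_right_inject)
    have "F_class s t = F_class s' t'" if "F_class t s = F_class t' s'" 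
      "leaves t = leaves s" "leaves t' = leaves s'" for t s t' s'
    proof (rule F_class_eq)
      have "F_rel t s t' s'" using that by (metis F_rel_refl mem_F_class)
      then show "F_rel s t s' t'" unfolding F_rel_def by metis
    qed
    from this[of "attach p m" "attach p r" "attach p m" "attach q r'"]
    show "F_class (attach p r) (attach p m) = F_class (attach q r') (attach p m)"
      using assms pq by (metis F_class_attach leaves_attach_eq)
    show "leaves (attach p r) = leaves (attach p m)" "leaves (attach q r') = leaves (attach p m)"
      using assms pq leaves_attach_eq by metis+
  qed
  ultimately have "F_class (attach p t) (attach p r) = F_class (attach q t') (attach q r')" by simp
  then show ?thesis using assms pq F_class_attach[of t r p] F_class_attach[of t' r' q] by simp
qed

lemma F_class_mult:
  assumes "leaves t = leaves m" "leaves m = leaves r"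
  shows "F_class t m \<otimes>\<^bsub>thompson_F\<^esub> F_class m r = F_class t r"
proof -
  define L where "L = {F_class (attach f a) (attach f' b') | f f' a b a' b'.
       (a, b) \<in> F_class t m \<and> (a', b') \<in> F_class m r \<and> length f = leaves b \<and>
       length f' = leaves a' \<and> attach f b = attach f' a'}"
  have "F_class t r \<in> L"
  proof -
    define f where "f = replicate (leaves m) Leaf"
    have "attach f t = t" "attach f r = r"
      unfolding f_def using assms attach_trivial by metis+
    moreover have "(t, m) \<in> F_class t m" "(m, r) \<in> F_class m r"
      unfolding mem_F_class by (rule F_rel_refl, fact)+
    moreover have "length f = leaves m" by (simp add: f_def)
    ultimately show ?thesis unfolding L_def mem_Collect_eq
      by (intro exI[of _ f] exI[of _ t] exI[of _ m] exI[of _ r]) simp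
  qed
  moreover have "X = F_class t r" if XL: "X \<in> L" for X
  proof -
    obtain f f' a b a' b' where X: "X = F_class (attach f a) (attach f' b')"
      and h: "(a, b) \<in> F_class t m" "(a', b') \<in> F_class m r" "length f = leaves b"
        "length f' = leaves a'" "attach f b = attach f' a'"
      using XL unfolding L_def by blast
    note D1 = F_classD[OF assms(1) h(1)] and D2 = F_classD[OF assms(2) h(2)]
    show ?thesis unfolding X
    proof (rule F_mult_unique[where m = "attach f b" and m' = m])
      show "F_class (attach f a) (attach f b) = F_class t m"
        using D1 h(3) F_class_attach[of a b f] by simp
      show "F_class (attach f b) (attach f' b') = F_class m r"
        unfolding h(5) using D2 h(4) F_class_attach[of a' b' f'] by simp
      show "leaves (attach f a) = leaves (attach f b)"
        using D1 h(3) leaves_attach_eq[of f a b] by simp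
      show "leaves (attach f b) = leaves (attach f' b')"
        unfolding h(5) using D2 h(4) leaves_attach_eq[of f' a' b'] by simp
    qed (rule assms)+
  qed
  ultimately have "L = {F_class t r}" by blast
  then show ?thesis unfolding thompson_F_def L_def by simp
qed

lemma F_common_tree:
  assumes "g \<in> carrier thompson_F" "h \<in> carrier thompson_F"
  obtains t m r where "leaves t = leaves m" "leaves m = leaves r" "g = F_class t m" "h = F_class m r"
proof -
  obtain t s where g: "leaves t = leaves s" "g = F_class t s" using F_carrierE assms by metis
  obtain t' s' where h: "leaves t' = leaves s'" "h = F_class t' s'" using F_carrierE assms by metis
  obtain p q where pq: "length p = leaves s" "length q = leaves t'" "attach p s = attach q t'"
    using common_refinement by blast
  have "leaves (attach p t) = leaves (attach p s)" "leaves (attach p s) = leaves (attach q s')"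
    using g h pq leaves_attach_eq by metis+
  moreover have "g = F_class (attach p t) (attach p s)" "h = F_class (attach p s) (attach q s')"
    using g h pq F_class_attach by (metis)+
  ultimately show ?thesis using that by blast
qed

lemma one_thompson_F: "\<one>\<^bsub>thompson_F\<^esub> = F_class t t"
  using F_class_attach[of Leaf Leaf "[t]"] by (simp add: thompson_F_def)

theorem group_thompson_F: "group thompson_F"
proof (rule groupI)
  fix x y z assume xyz: "x \<in> carrier thompson_F" "y \<in> carrier thompson_F" "z \<in> carrier thompson_F"
  obtain t m r where 1: "leaves t = leaves m" "leaves m = leaves r" "x = F_class t m" "y = F_class m r"
    using F_common_tree xyz by metis
  then show "x \<otimes>\<^bsub>thompson_F\<^esub> y \<in> carrier thompson_F"
    by (simp add: F_class_mult F_class_closed)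
  obtain a b where z: "leaves a = leaves b" "z = F_class a b" using F_carrierE xyz by metis
  obtain p q where pq: "length p = leaves r" "length q = leaves a" "attach p r = attach q a"
    using common_refinement by blast
  have "x = F_class (attach p t) (attach p m)" "y = F_class (attach p m) (attach p r)"
      "z = F_class (attach p r) (attach q b)"
    using 1 z pq F_class_attach by metis+
  then show "x \<otimes>\<^bsub>thompson_F\<^esub> y \<otimes>\<^bsub>thompson_F\<^esub> z = x \<otimes>\<^bsub>thompson_F\<^esub> (y \<otimes>\<^bsub>thompson_F\<^esub> z)"
    using 1 z pq leaves_attach_eq[of p t m] leaves_attach_eq[of p m r] leaves_attach_eq[of q a b]
    by (simp add: F_class_mult)
next
  show "\<one>\<^bsub>thompson_F\<^esub> \<in> carrier thompson_F"
    using F_class_closed[of Leaf Leaf] one_thompson_F[of Leaf] by simp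
next
  fix x assume "x \<in> carrier thompson_F"
  then obtain t s where x: "leaves t = leaves s" "x = F_class t s" using F_carrierE by metis
  then show "\<one>\<^bsub>thompson_F\<^esub> \<otimes>\<^bsub>thompson_F\<^esub> x = x"
    using one_thompson_F[of t] by (simp add: F_class_mult)
  have "F_class s t \<in> carrier thompson_F" "F_class s t \<otimes>\<^bsub>thompson_F\<^esub> x = \<one>\<^bsub>thompson_F\<^esub>"
    using x one_thompson_F[of s] by (simp_all add: F_class_mult F_class_closed)
  then show "\<exists>y\<in>carrier thompson_F. y \<otimes>\<^bsub>thompson_F\<^esub> x = \<one>\<^bsub>thompson_F\<^esub>" by blast
qed

subsection \<open>The direct limit\<close>

lemma bounded_clinearD:
  assumes "bounded_clinear T"
  shows "T (x + y) = T x + T y" "T (c *\<^sub>C x) = c *\<^sub>C T x"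
  using assms by (auto simp: bounded_clinear_def)

context
  fixes A B :: "'h::chilbert_space \<Rightarrow> 'h"
  assumes AB: "pythagorean_pair A B"
begin

lemma lin_A: "A (x + y) = A x + A y" "A (c *\<^sub>C x) = c *\<^sub>C A x"
  and lin_B: "B (x + y) = B x + B y" "B (c *\<^sub>C x) = c *\<^sub>C B x"
  using AB by (auto simp: pythagorean_pair_def bounded_clinearD)

lemma Phi_tree_add: "Phi_tree A B t (x + y) = map2 (+) (Phi_tree A B t x) (Phi_tree A B t y)"
  by (induction t arbitrary: x y) (simp_all add: lin_A lin_B)

lemma Phi_tree_scaleC: "Phi_tree A B t (c *\<^sub>C x) = map (scaleC c) (Phi_tree A B t x)"
  by (induction t arbitrary: x) (simp_all add: lin_A lin_B)

lemma Phi_tree_cinner: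
  "sum_list (map2 cinner (Phi_tree A B t x) (Phi_tree A B t y)) = cinner x y"
  by (induction t arbitrary: x y) (simp_all add: pythagorean_pair_cinner[OF AB])

lemma Phi_tree_inject: "Phi_tree A B t x = Phi_tree A B t y \<Longrightarrow> x = y"
proof (induction t arbitrary: x y)
  case (Node l r)
  have "cadjoint A (A z) + cadjoint B (B z) = z" for z
    using AB by (metis pythagorean_pair_def id_apply)
  moreover have "A x = A y" "B x = B y" using Node by auto
  ultimately show ?case by metis
qed simp

lemma Phi_add:
  "\<lbrakk>length \<xi> = length f; length \<eta> = length f\<rbrakk> \<Longrightarrow>
     Phi A B f (map2 (+) \<xi> \<eta>) = map2 (+) (Phi A B f \<xi>) (Phi A B f \<eta>)"
proof (induction f arbitrary: \<xi> \<eta>)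
  case (Cons t f)
  then show ?case by (auto simp: length_Suc_conv Phi_tree_add)
qed simp

lemma Phi_scaleC:
  "length \<xi> = length f \<Longrightarrow> Phi A B f (map (scaleC c) \<xi>) = map (scaleC c) (Phi A B f \<xi>)"
  by (induction \<xi> f rule: list_induct2) (simp_all add: Phi_tree_scaleC)

lemma Phi_cinner:
  "\<lbrakk>length \<xi> = length f; length \<eta> = length f\<rbrakk> \<Longrightarrow>
     sum_list (map2 cinner (Phi A B f \<xi>) (Phi A B f \<eta>)) = sum_list (map2 cinner \<xi> \<eta>)"
proof (induction f arbitrary: \<xi> \<eta>)
  case (Cons t f)
  then show ?case by (auto simp: length_Suc_conv Phi_tree_cinner)
qed simp

lemma Phi_inject:
  "\<lbrakk>length \<xi> = length f; length \<eta> = length f; Phi A B f \<xi> = Phi A B f \<eta>\<rbrakk> \<Longrightarrow> \<xi> = \<eta>"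
proof (induction f arbitrary: \<xi> \<eta>)
  case (Cons t f)
  then show ?case by (auto simp: length_Suc_conv dest: Phi_tree_inject)
qed simp

definition "lim_rel t \<xi> s \<eta> \<longleftrightarrow> length \<xi> = leaves t \<and> length \<eta> = leaves s \<and>
  (\<exists>f g. length f = leaves t \<and> length g = leaves s \<and> attach f t = attach g s \<and>
     Phi A B f \<xi> = Phi A B g \<eta>)"

lemma mem_limit_class: "(s, \<eta>) \<in> limit_class A B t \<xi> \<longleftrightarrow> lim_rel t \<xi> s \<eta>"
  by (auto simp: limit_class_def limit_equiv_def lim_rel_def decorated_trees_def)

lemma lim_rel_refl: "length \<xi> = leaves t \<Longrightarrow> lim_rel t \<xi> t \<xi>"
  unfolding lim_rel_def by (metis length_replicate)

lemma lim_rel_sym: "lim_rel t \<xi> s \<eta> \<Longrightarrow> lim_rel s \<eta> t \<xi>"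
  unfolding lim_rel_def by metis

lemma lim_rel_trans:
  assumes "lim_rel t \<xi> s \<eta>" "lim_rel s \<eta> r \<zeta>"
  shows "lim_rel t \<xi> r \<zeta>"
proof -
  obtain f g where fg: "length f = leaves t" "length g = leaves s"
      "attach f t = attach g s" "Phi A B f \<xi> = Phi A B g \<eta>"
    using assms(1) unfolding lim_rel_def by blast
  obtain h k where hk: "length h = leaves s" "length k = leaves r"
      "attach h s = attach k r" "Phi A B h \<eta> = Phi A B k \<zeta>"
    using assms(2) unfolding lim_rel_def by blast
  obtain p q where pq: "length p = forest_leaves g" "length q = forest_leaves h"
      "forest_comp p g = forest_comp q h"
    using attach_amalgam[OF fg(2) hk(1)] by blast
  have len: "length \<xi> = leaves t" "length \<eta> = leaves s" "length \<zeta> = leaves r"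
    using assms by (auto simp: lim_rel_def)
  have fl: "forest_leaves f = forest_leaves g" "forest_leaves h = forest_leaves k"
    using fg hk leaves_attach by metis+
  have "attach (forest_comp p f) t = attach p (attach g s)"
    using attach_attach[of f t p] fg pq fl by simp
  also have "\<dots> = attach q (attach h s)"
    using attach_attach[of g s p] attach_attach[of h s q] fg hk pq by simp
  also have "\<dots> = attach (forest_comp q k) r"
    using attach_attach[of k r q] hk pq fl by simp
  finally have 1: "attach (forest_comp p f) t = attach (forest_comp q k) r" .
  have "Phi A B (forest_comp p f) \<xi> = Phi A B p (Phi A B g \<eta>)"
    using Phi_comp[of \<xi> f p A B] fg pq fl len by simp
  also have "\<dots> = Phi A B q (Phi A B h \<eta>)"
    using Phi_comp[of \<eta> g p A B] Phi_comp[of \<eta> h q A B] fg hk pq len by simp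
  also have "\<dots> = Phi A B (forest_comp q k) \<zeta>"
    using Phi_comp[of \<zeta> k q A B] hk pq fl len by simp
  finally show ?thesis unfolding lim_rel_def using 1 len fg(1) hk(2) length_forest_comp by metis
qed

lemma limit_class_eq: "lim_rel t \<xi> s \<eta> \<Longrightarrow> limit_class A B t \<xi> = limit_class A B s \<eta>"
proof -
  assume *: "lim_rel t \<xi> s \<eta>"
  have "(a, b) \<in> limit_class A B t \<xi> \<longleftrightarrow> (a, b) \<in> limit_class A B s \<eta>" for a b
    unfolding mem_limit_class using * lim_rel_trans lim_rel_sym by meson
  then show ?thesis by auto
qed

lemma lim_rel_attach:
  assumes "length \<xi> = leaves t" "length f = leaves t"
  shows "lim_rel (attach f t) (Phi A B f \<xi>) t \<xi>"
proof -
  define g where "g = replicate (leaves (attach f t)) Leaf"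
  have "attach g (attach f t) = attach f t" by (simp add: g_def)
  moreover have "Phi A B g (Phi A B f \<xi>) = Phi A B f \<xi>"
    using assms by (simp add: g_def leaves_attach)
  moreover have "length g = leaves (attach f t)" by (simp add: g_def)
  moreover have "length (Phi A B f \<xi>) = leaves (attach f t)"
    using assms by (simp add: leaves_attach)
  ultimately show ?thesis unfolding lim_rel_def using assms by blast
qed

lemma limit_class_attach:
  "\<lbrakk>length \<xi> = leaves t; length f = leaves t\<rbrakk> \<Longrightarrow> limit_class A B (attach f t) (Phi A B f \<xi>) = limit_class A B t \<xi>"
  by (intro limit_class_eq lim_rel_attach)

lemma carrier_direct_limit: "X \<in> carrier (direct_limit A B) \<longleftrightarrow> (\<exists>t \<xi>. length \<xi> = leaves t \<and> X = limit_class A B t \<xi>)"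
  by (auto simp: direct_limit_def limit_class_def decorated_trees_def quotient_def)

lemma limit_class_closed: "length \<xi> = leaves t \<Longrightarrow> limit_class A B t \<xi> \<in> carrier (direct_limit A B)"
  using carrier_direct_limit by blast

lemma limit_class_memD:
  assumes "(t', \<xi>') \<in> limit_class A B t \<xi>"
  shows "length \<xi>' = leaves t'" "limit_class A B t' \<xi>' = limit_class A B t \<xi>"
  using assms limit_class_eq unfolding mem_limit_class by (simp add: lim_rel_def, metis)

lemma limit_class_self: "length \<xi> = leaves t \<Longrightarrow> (t, \<xi>) \<in> limit_class A B t \<xi>"
  by (simp add: mem_limit_class lim_rel_refl)

lemma limit_class_inject:
  assumes "limit_class A B t \<xi> = limit_class A B t \<eta>" "length \<xi> = leaves t" "length \<eta> = leaves t"
  shows "\<xi> = \<eta>"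
proof -
  have "lim_rel t \<xi> t \<eta>" using assms limit_class_self mem_limit_class by metis
  then obtain f g where fg: "length f = leaves t" "length g = leaves t" "attach f t = attach g t"
      "Phi A B f \<xi> = Phi A B g \<eta>"
    unfolding lim_rel_def by blast
  have "f = g" by (rule attach_inject[OF fg(1-3)])
  with fg have "Phi A B f \<xi> = Phi A B f \<eta>" by simp
  with assms fg(1) show ?thesis using Phi_inject[of \<xi> f \<eta>] by simp
qed

lemma limit_class_compare:
  assumes "length \<xi> = leaves t" "length \<eta> = leaves t" "length \<xi>' = leaves t'" "length \<eta>' = leaves t'"
    and "limit_class A B t' \<xi>' = limit_class A B t \<xi>" "limit_class A B t' \<eta>' = limit_class A B t \<eta>"
  obtains p q where "length p = leaves t" "length q = leaves t'" "attach p t = attach q t'"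
    "Phi A B p \<xi> = Phi A B q \<xi>'" "Phi A B p \<eta> = Phi A B q \<eta>'"
proof -
  obtain p q where pq: "length p = leaves t" "length q = leaves t'" "attach p t = attach q t'"
    using common_refinement by blast
  have fl: "leaves (attach p t) = forest_leaves p" "leaves (attach p t) = forest_leaves q"
    using pq leaves_attach by metis+
  have *: "Phi A B p x = Phi A B q x'"
    if "length x = leaves t" "length x' = leaves t'" "limit_class A B t' x' = limit_class A B t x" for x x'
  proof (rule limit_class_inject)
    show "limit_class A B (attach p t) (Phi A B p x) = limit_class A B (attach p t) (Phi A B q x')"
      using that pq limit_class_attach[of x t p] limit_class_attach[of x' t' q] by simp
  qed (use that pq fl in simp_all)
  show ?thesis by (rule that[OF pq *[OF assms(1,3,5)] *[OF assms(2,4,6)]])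
qed

lemma direct_limit_common:
  assumes "X \<in> carrier (direct_limit A B)" "Y \<in> carrier (direct_limit A B)"
  obtains t \<xi> \<eta> where "length \<xi> = leaves t" "length \<eta> = leaves t" "X = limit_class A B t \<xi>" "Y = limit_class A B t \<eta>"
proof -
  obtain t \<xi> where X: "length \<xi> = leaves t" "X = limit_class A B t \<xi>" using assms carrier_direct_limit by blast
  obtain s \<eta> where Y: "length \<eta> = leaves s" "Y = limit_class A B s \<eta>" using assms carrier_direct_limit by blast
  obtain p q where pq: "length p = leaves t" "length q = leaves s" "attach p t = attach q s"
    using common_refinement by blast
  have "X = limit_class A B (attach p t) (Phi A B p \<xi>)" "Y = limit_class A B (attach p t) (Phi A B q \<eta>)"
    using X Y pq limit_class_attach by metis+
  moreover have "length (Phi A B p \<xi>) = leaves (attach p t)" using X pq(1) by (simp add: leaves_attach)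
  moreover have "length (Phi A B q \<eta>) = leaves (attach p t)"
    unfolding pq(3) using Y pq(2) by (simp add: leaves_attach)
  ultimately show ?thesis using that by blast
qed

lemma direct_limit_common3:
  assumes "X \<in> carrier (direct_limit A B)" "Y \<in> carrier (direct_limit A B)" "Z \<in> carrier (direct_limit A B)"
  obtains t \<xi> \<eta> \<zeta> where "length \<xi> = leaves t" "length \<eta> = leaves t" "length \<zeta> = leaves t"
    "X = limit_class A B t \<xi>" "Y = limit_class A B t \<eta>" "Z = limit_class A B t \<zeta>"
proof -
  obtain t \<xi> \<eta> where XY: "length \<xi> = leaves t" "length \<eta> = leaves t" "X = limit_class A B t \<xi>" "Y = limit_class A B t \<eta>"
    using direct_limit_common assms by blast
  obtain s \<zeta> where Z: "length \<zeta> = leaves s" "Z = limit_class A B s \<zeta>" using assms carrier_direct_limit by blast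
  obtain p q where pq: "length p = leaves t" "length q = leaves s" "attach p t = attach q s"
    using common_refinement by blast
  have "X = limit_class A B (attach p t) (Phi A B p \<xi>)" "Y = limit_class A B (attach p t) (Phi A B p \<eta>)"
      "Z = limit_class A B (attach p t) (Phi A B q \<zeta>)"
    using XY Z pq limit_class_attach by metis+
  moreover have "length (Phi A B p \<xi>) = leaves (attach p t)" "length (Phi A B p \<eta>) = leaves (attach p t)"
    using XY pq(1) by (simp_all add: leaves_attach)
  moreover have "length (Phi A B q \<zeta>) = leaves (attach p t)"
    unfolding pq(3) using Z pq(2) by (simp add: leaves_attach)
  ultimately show ?thesis using that by blast
qed

lemma direct_limit_add:
  assumes "length \<xi> = leaves t" "length \<eta> = leaves t"
  shows "vadd (direct_limit A B) (limit_class A B t \<xi>) (limit_class A B t \<eta>) = limit_class A B t (map2 (+) \<xi> \<eta>)"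
proof -
  define L where "L = {limit_class A B t' (map2 (+) \<xi>' \<eta>') | t' \<xi>' \<eta>'. (t', \<xi>') \<in> limit_class A B t \<xi> \<and> (t', \<eta>') \<in> limit_class A B t \<eta>}"
  have "limit_class A B t (map2 (+) \<xi> \<eta>) \<in> L" using assms limit_class_self unfolding L_def by blast
  moreover have "X = limit_class A B t (map2 (+) \<xi> \<eta>)" if XL: "X \<in> L" for X
  proof -
    obtain t' \<xi>' \<eta>' where X: "X = limit_class A B t' (map2 (+) \<xi>' \<eta>')" and
      mem: "(t', \<xi>') \<in> limit_class A B t \<xi>" "(t', \<eta>') \<in> limit_class A B t \<eta>"
      using XL unfolding L_def by blast
    note D = limit_class_memD[OF mem(1)] limit_class_memD[OF mem(2)]
    obtain p q where pq: "length p = leaves t" "length q = leaves t'" "attach p t = attach q t'"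
        "Phi A B p \<xi> = Phi A B q \<xi>'" "Phi A B p \<eta> = Phi A B q \<eta>'"
      using limit_class_compare[OF assms D(1,3,2,4)] by blast
    have "X = limit_class A B (attach q t') (Phi A B q (map2 (+) \<xi>' \<eta>'))"
      unfolding X using limit_class_attach[of "map2 (+) \<xi>' \<eta>'" t' q] D pq(2) by simp
    also have "Phi A B q (map2 (+) \<xi>' \<eta>') = Phi A B p (map2 (+) \<xi> \<eta>)"
      using Phi_add[of \<xi> p \<eta>] Phi_add[of \<xi>' q \<eta>'] D(1,3) assms pq by simp
    also have "limit_class A B (attach q t') \<dots> = limit_class A B t (map2 (+) \<xi> \<eta>)"
      unfolding pq(3)[symmetric] using limit_class_attach[of "map2 (+) \<xi> \<eta>" t p] assms pq(1) by simp
    finally show ?thesis .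
  qed
  ultimately have "L = {limit_class A B t (map2 (+) \<xi> \<eta>)}" by blast
  then show ?thesis unfolding direct_limit_def L_def by simp
qed

lemma direct_limit_scale:
  assumes "length \<xi> = leaves t"
  shows "vscale (direct_limit A B) c (limit_class A B t \<xi>) = limit_class A B t (map (scaleC c) \<xi>)"
proof -
  define L where "L = {limit_class A B t' (map (scaleC c) \<xi>') | t' \<xi>'. (t', \<xi>') \<in> limit_class A B t \<xi>}"
  have "limit_class A B t (map (scaleC c) \<xi>) \<in> L" using assms limit_class_self unfolding L_def by blast
  moreover have "X = limit_class A B t (map (scaleC c) \<xi>)" if XL: "X \<in> L" for X
  proof -
    obtain t' \<xi>' where X: "X = limit_class A B t' (map (scaleC c) \<xi>')" and mem: "(t', \<xi>') \<in> limit_class A B t \<xi>"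
      using XL unfolding L_def by blast
    note D = limit_class_memD[OF mem]
    obtain p q where pq: "length p = leaves t" "length q = leaves t'" "attach p t = attach q t'"
        "Phi A B p \<xi> = Phi A B q \<xi>'"
      using limit_class_compare[OF assms assms D(1,1,2,2)] by blast
    have "X = limit_class A B (attach q t') (Phi A B q (map (scaleC c) \<xi>'))"
      unfolding X using limit_class_attach[of "map (scaleC c) \<xi>'" t' q] D pq(2) by simp
    also have "Phi A B q (map (scaleC c) \<xi>') = Phi A B p (map (scaleC c) \<xi>)"
      using Phi_scaleC[of \<xi> p c] Phi_scaleC[of \<xi>' q c] D(1) assms pq by simp
    also have "limit_class A B (attach q t') \<dots> = limit_class A B t (map (scaleC c) \<xi>)"
      unfolding pq(3)[symmetric] using limit_class_attach[of "map (scaleC c) \<xi>" t p] assms pq(1) by simp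
    finally show ?thesis .
  qed
  ultimately have "L = {limit_class A B t (map (scaleC c) \<xi>)}" by blast
  then show ?thesis unfolding direct_limit_def L_def by simp
qed

lemma direct_limit_inner:
  assumes "length \<xi> = leaves t" "length \<eta> = leaves t"
  shows "vinner (direct_limit A B) (limit_class A B t \<xi>) (limit_class A B t \<eta>) = sum_list (map2 cinner \<xi> \<eta>)"
proof -
  have "(THE c. \<exists>t' \<xi>' \<eta>'. (t', \<xi>') \<in> limit_class A B t \<xi> \<and> (t', \<eta>') \<in> limit_class A B t \<eta> \<and>
      c = sum_list (map2 cinner \<xi>' \<eta>')) = sum_list (map2 cinner \<xi> \<eta>)"
  proof (rule the_equality)
    show "\<exists>t' \<xi>' \<eta>'. (t', \<xi>') \<in> limit_class A B t \<xi> \<and> (t', \<eta>') \<in> limit_class A B t \<eta> \<and>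
        sum_list (map2 cinner \<xi> \<eta>) = sum_list (map2 cinner \<xi>' \<eta>')"
      using assms limit_class_self by blast
  next
    fix c assume "\<exists>t' \<xi>' \<eta>'. (t', \<xi>') \<in> limit_class A B t \<xi> \<and> (t', \<eta>') \<in> limit_class A B t \<eta> \<and>
        c = sum_list (map2 cinner \<xi>' \<eta>')"
    then obtain t' \<xi>' \<eta>' where c: "c = sum_list (map2 cinner \<xi>' \<eta>')" and
      mem: "(t', \<xi>') \<in> limit_class A B t \<xi>" "(t', \<eta>') \<in> limit_class A B t \<eta>" by blast
    note D = limit_class_memD[OF mem(1)] limit_class_memD[OF mem(2)]
    obtain p q where pq: "length p = leaves t" "length q = leaves t'" "attach p t = attach q t'"
        "Phi A B p \<xi> = Phi A B q \<xi>'" "Phi A B p \<eta> = Phi A B q \<eta>'"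
      using limit_class_compare[OF assms D(1,3,2,4)] by blast
    then show "c = sum_list (map2 cinner \<xi> \<eta>)"
      unfolding c using Phi_cinner[of \<xi> p \<eta>] Phi_cinner[of \<xi>' q \<eta>'] D(1,3) assms by simp
  qed
  then show ?thesis by (simp add: direct_limit_def)
qed

lemma Phi_tree_zero: "Phi_tree A B t 0 = replicate (leaves t) 0"
proof (induction t)
  case (Node l r)
  have "A 0 = 0" "B 0 = 0" using lin_A(1)[of 0 0] lin_B(1)[of 0 0] by simp_all
  with Node show ?case by (simp add: replicate_add)
qed simp

lemma direct_limit_zero: "vzero (direct_limit A B) = limit_class A B t (replicate (leaves t) 0)"
  using limit_class_attach[of "[0]" Leaf "[t]"] Phi_tree_zero[of t] by (simp add: direct_limit_def)

lemma sum_list_cinner_commute: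
  "length \<xi> = length \<eta> \<Longrightarrow>
     sum_list (map2 cinner \<xi> \<eta>) = cnj (sum_list (map2 cinner \<eta> (\<xi>::'h list)))"
  by (induction \<xi> \<eta> rule: list_induct2) (simp_all add: cinner_commute[symmetric])

lemma sum_list_cinner_add:
  "\<lbrakk>length \<xi> = length \<eta>; length \<eta> = length \<zeta>\<rbrakk> \<Longrightarrow> sum_list (map2 cinner \<xi> (map2 (+) \<eta> \<zeta>)) =
     sum_list (map2 cinner \<xi> \<eta>) + sum_list (map2 cinner \<xi> (\<zeta>::'h list))"
  by (induction \<xi> \<eta> \<zeta> rule: list_induct3) (simp_all add: cinner_add_right)

lemma sum_list_cinner_scaleC:
  "length \<xi> = length \<eta> \<Longrightarrow> sum_list (map2 cinner \<xi> (map (scaleC c) \<eta>)) =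
     c * sum_list (map2 cinner \<xi> (\<eta>::'h list))"
  by (induction \<xi> \<eta> rule: list_induct2) (simp_all add: cinner_scaleC_right algebra_simps)

lemma sum_list_cinner_self:
  "sum_list (map2 cinner \<xi> (\<xi>::'h list)) = complex_of_real (\<Sum>x\<leftarrow>\<xi>. (norm x)\<^sup>2)"
  by (induction \<xi>) (simp_all add: cinner_self)

lemma complex_inner_space_direct_limit: "complex_inner_space (direct_limit A B)"
proof
  fix x y z :: "(tree \<times> 'h list) set" and c d :: complex
  assume x: "x \<in> carrier (direct_limit A B)"
  then obtain t \<xi> where X: "length \<xi> = leaves t" "x = limit_class A B t \<xi>" using carrier_direct_limit by blast
  show "vscale (direct_limit A B) c x \<in> carrier (direct_limit A B)" using X by (simp add: direct_limit_scale limit_class_closed)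
  show "vadd (direct_limit A B) x (vzero (direct_limit A B)) = x"
  proof -
    have "map2 (+) \<xi> (replicate (length \<xi>) 0) = \<xi>" by (induction \<xi>) auto
    then show ?thesis using X by (simp add: direct_limit_zero[of t] direct_limit_add)
  qed
  show "vadd (direct_limit A B) x (vscale (direct_limit A B) (- 1) x) = vzero (direct_limit A B)"
  proof -
    have "map2 (+) \<xi> (map (scaleC (- 1)) \<xi>) = replicate (length \<xi>) 0"
      by (induction \<xi>) (auto simp: scaleC_minus_one)
    then show ?thesis using X by (simp add: direct_limit_zero[of t] direct_limit_add direct_limit_scale)
  qed
  show "vscale (direct_limit A B) (c + d) x = vadd (direct_limit A B) (vscale (direct_limit A B) c x) (vscale (direct_limit A B) d x)"
  proof -
    have "map (scaleC (c + d)) \<xi> = map2 (+) (map (scaleC c) \<xi>) (map (scaleC d) \<xi>)"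
      by (induction \<xi>) (auto simp: scaleC_add_left)
    then show ?thesis using X by (simp add: direct_limit_add direct_limit_scale)
  qed
  show "vscale (direct_limit A B) c (vscale (direct_limit A B) d x) = vscale (direct_limit A B) (c * d) x"
    using X by (simp add: direct_limit_scale scaleC_scaleC comp_def)
  show "vscale (direct_limit A B) 1 x = x" using X by (simp add: direct_limit_scale map_idI)
  show "0 \<le> Re (vinner (direct_limit A B) x x)"
    using X by (auto simp: direct_limit_inner sum_list_cinner_self intro!: sum_list_nonneg)
  show "x = vzero (direct_limit A B)" if "vinner (direct_limit A B) x x = 0"
  proof -
    have "complex_of_real (\<Sum>x\<leftarrow>\<xi>. (norm x)\<^sup>2) = 0"
      using that unfolding X(2) direct_limit_inner[OF X(1) X(1)] sum_list_cinner_self .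
    then have "(\<Sum>x\<leftarrow>\<xi>. (norm x)\<^sup>2) = 0" by (simp only: of_real_eq_0_iff)
    then have "\<forall>v\<in>set \<xi>. v = 0"
      by (subst (asm) sum_list_nonneg_eq_0_iff) auto
    then have "\<xi> = replicate (leaves t) 0" using X(1) by (simp add: replicate_eqI)
    then show ?thesis unfolding X(2) direct_limit_zero[of t] by simp
  qed
  assume y: "y \<in> carrier (direct_limit A B)"
  from direct_limit_common[OF x y] obtain t \<xi> \<eta> where
    XY: "length \<xi> = leaves t" "length \<eta> = leaves t" "x = limit_class A B t \<xi>" "y = limit_class A B t \<eta>" .
  then have l2: "length \<xi> = length \<eta>" by simp
  show "vadd (direct_limit A B) x y \<in> carrier (direct_limit A B)" using XY by (simp add: direct_limit_add limit_class_closed)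
  show "vadd (direct_limit A B) x y = vadd (direct_limit A B) y x"
  proof -
    have "map2 (+) \<xi> \<eta> = map2 (+) \<eta> \<xi>" using l2 by (induction \<xi> \<eta> rule: list_induct2) auto
    then show ?thesis using XY by (simp add: direct_limit_add)
  qed
  show "vscale (direct_limit A B) c (vadd (direct_limit A B) x y) = vadd (direct_limit A B) (vscale (direct_limit A B) c x) (vscale (direct_limit A B) c y)"
  proof -
    have "map (scaleC c) (map2 (+) \<xi> \<eta>) = map2 (+) (map (scaleC c) \<xi>) (map (scaleC c) \<eta>)"
      using l2 by (induction \<xi> \<eta> rule: list_induct2) (auto simp: scaleC_add_right)
    then show ?thesis using XY by (simp add: direct_limit_add direct_limit_scale)
  qed
  show "vinner (direct_limit A B) x y = cnj (vinner (direct_limit A B) y x)"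
    using XY l2 sum_list_cinner_commute[of \<xi> \<eta>] by (simp add: direct_limit_inner)
  show "vinner (direct_limit A B) x (vscale (direct_limit A B) c y) = c * vinner (direct_limit A B) x y"
    using XY l2 sum_list_cinner_scaleC[of \<xi> \<eta> c] by (simp add: direct_limit_inner direct_limit_scale)
  assume z: "z \<in> carrier (direct_limit A B)"
  from direct_limit_common3[OF x y z] obtain t \<xi> \<eta> \<zeta> where
    XYZ: "length \<xi> = leaves t" "length \<eta> = leaves t" "length \<zeta> = leaves t"
      "x = limit_class A B t \<xi>" "y = limit_class A B t \<eta>" "z = limit_class A B t \<zeta>" .
  then have l3: "length \<xi> = length \<eta>" "length \<eta> = length \<zeta>" by simp_all
  show "vadd (direct_limit A B) (vadd (direct_limit A B) x y) z = vadd (direct_limit A B) x (vadd (direct_limit A B) y z)"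
  proof -
    have "map2 (+) (map2 (+) \<xi> \<eta>) \<zeta> = map2 (+) \<xi> (map2 (+) \<eta> \<zeta>)"
      using l3 by (induction \<xi> \<eta> \<zeta> rule: list_induct3) (auto simp: add.assoc)
    then show ?thesis using XYZ by (simp add: direct_limit_add)
  qed
  show "vinner (direct_limit A B) x (vadd (direct_limit A B) y z) = vinner (direct_limit A B) x y + vinner (direct_limit A B) x z"
    using XYZ l3 sum_list_cinner_add[of \<xi> \<eta> \<zeta>] by (simp add: direct_limit_inner direct_limit_add)
next
  show "vzero (direct_limit A B) \<in> carrier (direct_limit A B)" using direct_limit_zero[of Leaf] limit_class_closed[of "[0]" Leaf] by simp
qed

subsection \<open>The representation on the direct limit\<close>

lemma limit_rep_class:
  assumes "leaves t = leaves s" "length \<xi> = leaves s"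
  shows "limit_rep A B (F_class t s) (limit_class A B s \<xi>) = limit_class A B t \<xi>"
proof -
  define L where "L = {limit_class A B t' \<xi>' | t' s' \<xi>'. (t', s') \<in> F_class t s \<and> (s', \<xi>') \<in> limit_class A B s \<xi>}"
  have "limit_class A B t \<xi> \<in> L"
    using assms limit_class_self mem_F_class F_rel_refl unfolding L_def by blast
  moreover have "X = limit_class A B t \<xi>" if XL: "X \<in> L" for X
  proof -
    obtain t' s' \<xi>' where X: "X = limit_class A B t' \<xi>'" and
      mem: "(t', s') \<in> F_class t s" "(s', \<xi>') \<in> limit_class A B s \<xi>"
      using XL unfolding L_def by blast
    note D = F_classD[OF assms(1) mem(1)] limit_class_memD[OF mem(2)]
    obtain p q where pq: "length p = leaves s" "length q = leaves s'" "attach p s = attach q s'"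
        "Phi A B p \<xi> = Phi A B q \<xi>'"
      using limit_class_compare[OF assms(2,2) D(3,3,4,4)] by blast
    have "attach p t = attach q t'"
    proof (rule F_class_right_inject)
      show "F_class (attach p t) (attach p s) = F_class (attach q t') (attach p s)"
        using F_class_attach[of t s p] F_class_attach[of t' s' q] D assms pq by simp
      show "leaves (attach p t) = leaves (attach p s)"
        using leaves_attach_eq[of p t s] assms pq(1) by simp
      show "leaves (attach q t') = leaves (attach p s)"
        unfolding pq(3) using leaves_attach_eq[of q t' s'] D(1) pq(2) by simp
    qed
    then show ?thesis
      unfolding X using limit_class_attach[of \<xi> t p] limit_class_attach[of \<xi>' t' q] D(1,3) assms pq by simp
  qed
  ultimately have "L = {limit_class A B t \<xi>}" by blast
  then show ?thesis unfolding limit_rep_def L_def by simp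
qed

lemma direct_limit_rep_common:
  assumes "g \<in> carrier thompson_F" "X \<in> carrier (direct_limit A B)" "Y \<in> carrier (direct_limit A B)"
  obtains t s \<xi> \<eta> where "leaves t = leaves s" "length \<xi> = leaves s" "length \<eta> = leaves s"
    "g = F_class t s" "X = limit_class A B s \<xi>" "Y = limit_class A B s \<eta>"
proof -
  obtain t s where g: "leaves t = leaves s" "g = F_class t s" using F_carrierE assms by metis
  obtain r \<xi> \<eta> where XY: "length \<xi> = leaves r" "length \<eta> = leaves r" "X = limit_class A B r \<xi>" "Y = limit_class A B r \<eta>"
    using direct_limit_common assms by blast
  obtain p q where pq: "length p = leaves s" "length q = leaves r" "attach p s = attach q r"
    using common_refinement by blast
  have "g = F_class (attach p t) (attach p s)" using g pq F_class_attach[of t s p] by simp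
  moreover have "X = limit_class A B (attach p s) (Phi A B q \<xi>)" "Y = limit_class A B (attach p s) (Phi A B q \<eta>)"
    unfolding pq(3) using XY pq(2) limit_class_attach by simp_all
  moreover have "length (Phi A B q \<xi>) = leaves (attach p s)" "length (Phi A B q \<eta>) = leaves (attach p s)"
    unfolding pq(3) using XY pq(2) by (simp_all add: leaves_attach)
  moreover have "leaves (attach p t) = leaves (attach p s)"
    using leaves_attach_eq[of p t s] g pq(1) by simp
  ultimately show ?thesis using that by blast
qed

lemma limit_rep_closed:
  assumes "g \<in> carrier thompson_F" "X \<in> carrier (direct_limit A B)"
  shows "limit_rep A B g X \<in> carrier (direct_limit A B)"
  by (rule direct_limit_rep_common[OF assms(1,2,2)]) (simp add: limit_rep_class limit_class_closed)

lemma limit_rep_add: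
  assumes "g \<in> carrier thompson_F" "X \<in> carrier (direct_limit A B)" "Y \<in> carrier (direct_limit A B)"
  shows "limit_rep A B g (vadd (direct_limit A B) X Y) = vadd (direct_limit A B) (limit_rep A B g X) (limit_rep A B g Y)"
  by (rule direct_limit_rep_common[OF assms]) (simp add: limit_rep_class direct_limit_add)

lemma limit_rep_scale:
  assumes "g \<in> carrier thompson_F" "X \<in> carrier (direct_limit A B)"
  shows "limit_rep A B g (vscale (direct_limit A B) c X) = vscale (direct_limit A B) c (limit_rep A B g X)"
  by (rule direct_limit_rep_common[OF assms(1,2,2)]) (simp add: limit_rep_class direct_limit_scale)

lemma limit_rep_inner:
  assumes "g \<in> carrier thompson_F" "X \<in> carrier (direct_limit A B)" "Y \<in> carrier (direct_limit A B)"
  shows "vinner (direct_limit A B) (limit_rep A B g X) (limit_rep A B g Y) = vinner (direct_limit A B) X Y"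
  by (rule direct_limit_rep_common[OF assms]) (simp add: limit_rep_class direct_limit_inner)

lemma limit_rep_mult:
  assumes "g \<in> carrier thompson_F" "h \<in> carrier thompson_F" "X \<in> carrier (direct_limit A B)"
  shows "limit_rep A B (g \<otimes>\<^bsub>thompson_F\<^esub> h) X = limit_rep A B g (limit_rep A B h X)"
proof -
  obtain a b where g: "leaves a = leaves b" "g = F_class a b" using F_carrierE assms by metis
  obtain t s \<xi> where h: "leaves t = leaves s" "length \<xi> = leaves s" "h = F_class t s" "X = limit_class A B s \<xi>"
    using direct_limit_rep_common[OF assms(2,3,3)] by metis
  obtain p q where pq: "length p = leaves b" "length q = leaves t" "attach p b = attach q t"
    using common_refinement by blast
  have 1: "g = F_class (attach p a) (attach q t)"
    using F_class_attach[of a b p] g pq by simp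
  have 2: "h = F_class (attach q t) (attach q s)"
    using F_class_attach[of t s q] h pq by simp
  have 3: "X = limit_class A B (attach q s) (Phi A B q \<xi>)"
    using limit_class_attach[of \<xi> s q] h pq by simp
  have l: "leaves (attach p a) = leaves (attach q t)" "leaves (attach q t) = leaves (attach q s)"
      "length (Phi A B q \<xi>) = leaves (attach q s)"
    using g h pq leaves_attach_eq[of p a b] leaves_attach_eq[of q t s] leaves_attach[of q s] by simp_all
  show ?thesis unfolding 1 2 3 using l by (simp add: F_class_mult limit_rep_class)
qed

lemma limit_rep_one: "X \<in> carrier (direct_limit A B) \<Longrightarrow> limit_rep A B \<one>\<^bsub>thompson_F\<^esub> X = X"
  using carrier_direct_limit[of X] one_thompson_F limit_rep_class by metis

end

subsection \<open>Elementary facts on inner product spaces\<close>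

context complex_inner_space
begin

lemma vinner_add_left: "\<lbrakk>x \<in> carrier S; y \<in> carrier S; z \<in> carrier S\<rbrakk> \<Longrightarrow>
    vinner S (vadd S x y) z = vinner S x z + vinner S y z"
  by (metis vinner_commute vinner_add_right vadd_closed complex_cnj_add)

lemma vinner_scale_left: "\<lbrakk>x \<in> carrier S; y \<in> carrier S\<rbrakk> \<Longrightarrow>
    vinner S (vscale S c x) y = cnj c * vinner S x y"
  by (metis vinner_commute vinner_scale_right vscale_closed complex_cnj_mult)

lemma vinner_self: "x \<in> carrier S \<Longrightarrow> vinner S x x = complex_of_real ((vnorm S x)\<^sup>2)"
proof -
  assume x: "x \<in> carrier S"
  have "Im (vinner S x x) = 0" using vinner_commute[OF x x] by (metis complex_cnj_cancel_iff cnj.simps(2) equal_neg_zero)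
  with vinner_pos[OF x] show ?thesis by (simp add: vnorm_def complex_eq_iff)
qed

lemma vzero_scale: "vscale S 0 (vzero S) = vzero S"
  using vadd_zero[of "vscale S 0 (vzero S)"] vscale_add_left[of "vzero S" 1 "- 1"]
    vadd_uminus[of "vzero S"] vscale_one[of "vzero S"] vzero_closed by simp

lemma vinner_zero [simp]: "x \<in> carrier S \<Longrightarrow> vinner S x (vzero S) = 0"
  using vinner_scale_right[of x "vzero S" 0] vzero_closed by (simp add: vzero_scale)

lemma vinner_zero_left [simp]: "x \<in> carrier S \<Longrightarrow> vinner S (vzero S) x = 0"
  using vinner_commute[OF vzero_closed] by simp

lemma vnorm_nonneg: "x \<in> carrier S \<Longrightarrow> 0 \<le> vnorm S x"
  by (simp add: vnorm_def vinner_pos)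

lemma vnorm_zero_iff: "x \<in> carrier S \<Longrightarrow> vnorm S x = 0 \<longleftrightarrow> x = vzero S"
proof
  assume "x \<in> carrier S" "vnorm S x = 0"
  then show "x = vzero S" using vinner_self vinner_definite by simp
next
  assume "x = vzero S"
  then show "vnorm S x = 0" using vinner_zero[OF vzero_closed] by (simp add: vnorm_def)
qed

lemma vnorm_zero [simp]: "vnorm S (vzero S) = 0"
  by (simp add: vnorm_zero_iff vzero_closed)

lemma vsub_eq_zero:
  assumes "x \<in> carrier S" "y \<in> carrier S" "vadd S x (vscale S (- 1) y) = vzero S"
  shows "x = y"
proof -
  have "x = vadd S x (vadd S (vscale S (- 1) y) y)"
    using assms by (metis vadd_zero vadd_uminus vadd_commute vscale_closed)
  also have "\<dots> = vadd S (vadd S x (vscale S (- 1) y)) y"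
    using vadd_assoc[OF assms(1) vscale_closed[OF assms(2)] assms(2)] by (rule sym)
  also have "\<dots> = y" using assms by (metis vadd_zero vadd_commute vzero_closed)
  finally show ?thesis .
qed

text \<open>Vector identities reduce to complex arithmetic.\<close>

lemma vector_eqI:
  assumes "x \<in> carrier S" "y \<in> carrier S" "\<And>z. z \<in> carrier S \<Longrightarrow> vinner S z x = vinner S z y"
  shows "x = y"
proof (rule vsub_eq_zero[OF assms(1,2)])
  let ?w = "vadd S x (vscale S (- 1) y)"
  have w: "?w \<in> carrier S" using assms vadd_closed vscale_closed by blast
  have "vinner S ?w ?w = vinner S ?w x - vinner S ?w y"
    using vinner_add_right[OF w assms(1) vscale_closed[OF assms(2)], of "-1"]
      vinner_scale_right[OF w assms(2), of "-1"] by simp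
  also have "\<dots> = 0" using assms(3)[OF w] by simp
  finally show "?w = vzero S" using vinner_definite w by blast
qed

lemmas vclosed = vadd_closed vscale_closed vzero_closed
lemmas vinner_simps = vinner_add_left vinner_add_right vinner_scale_left vinner_scale_right

lemma vnorm_add_sq: "\<lbrakk>x \<in> carrier S; y \<in> carrier S\<rbrakk> \<Longrightarrow>
    (vnorm S (vadd S x y))\<^sup>2 = (vnorm S x)\<^sup>2 + (vnorm S y)\<^sup>2 + 2 * Re (vinner S x y)"
proof -
  assume x: "x \<in> carrier S" and y: "y \<in> carrier S"
  have sq: "(vnorm S z)\<^sup>2 = Re (vinner S z z)" if "z \<in> carrier S" for z
    using vinner_self[OF that] by simp
  have "Re (vinner S y x) = Re (vinner S x y)" using vinner_commute[OF y x] by simp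
  then show ?thesis using x y by (simp add: sq vclosed vinner_simps)
qed

lemma vnorm_scale: "x \<in> carrier S \<Longrightarrow> vnorm S (vscale S c x) = cmod c * vnorm S x"
proof -
  assume x: "x \<in> carrier S"
  have "vinner S (vscale S c x) (vscale S c x) = c * cnj c * vinner S x x"
    using x by (simp add: vclosed vinner_simps)
  also have "\<dots> = complex_of_real ((cmod c)\<^sup>2 * (vnorm S x)\<^sup>2)"
    using x by (simp only: complex_norm_square[symmetric] vinner_self of_real_mult)
  finally have "Re (vinner S (vscale S c x) (vscale S c x)) = (cmod c * vnorm S x)\<^sup>2"
    by (simp only: Re_complex_of_real power_mult_distrib)
  then show ?thesis
    using vnorm_nonneg[OF x] unfolding vnorm_def[of S "vscale S c x"] by simp
qed

lemma Re_vinner_le: "\<lbrakk>x \<in> carrier S; y \<in> carrier S\<rbrakk> \<Longrightarrow> Re (vinner S x y) \<le> vnorm S x * vnorm S y"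
proof -
  assume x: "x \<in> carrier S" and y: "y \<in> carrier S"
  define a b where "a = vnorm S x" "b = vnorm S y"
  have ab: "0 \<le> a" "0 \<le> b" using x y vnorm_nonneg by (auto simp: a_b_def)
  show ?thesis
  proof (cases "a = 0 \<or> b = 0")
    case True
    then have "x = vzero S \<or> y = vzero S" using x y vnorm_zero_iff by (simp add: a_b_def)
    then show ?thesis using x y by auto
  next
    case False
    with ab have pos: "0 < a * b" by simp
    let ?z = "vadd S (vscale S (of_real b) x) (vscale S (of_real (- a)) y)"
    have "(vnorm S ?z)\<^sup>2 = (b * a)\<^sup>2 + (a * b)\<^sup>2 + 2 * Re (of_real (- a) * (of_real b * vinner S x y))"
      using x y ab by (simp add: vnorm_add_sq vclosed vnorm_scale vinner_simps
          del: of_real_minus) (simp add: a_b_def)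
    also have "\<dots> = 2 * ((a * b) * (a * b - Re (vinner S x y)))"
      by (simp add: power2_eq_square algebra_simps)
    finally have "0 \<le> (a * b) * (a * b - Re (vinner S x y))"
      using zero_le_power2[of "vnorm S ?z"] by simp
    with pos show ?thesis by (simp add: zero_le_mult_iff a_b_def)
  qed
qed

lemma vnorm_triangle: "\<lbrakk>x \<in> carrier S; y \<in> carrier S\<rbrakk> \<Longrightarrow> vnorm S (vadd S x y) \<le> vnorm S x + vnorm S y"
proof -
  assume x: "x \<in> carrier S" and y: "y \<in> carrier S"
  have "(vnorm S (vadd S x y))\<^sup>2 \<le> (vnorm S x + vnorm S y)\<^sup>2"
    using x y Re_vinner_le[OF x y] by (simp add: vnorm_add_sq power2_sum)
  then show ?thesis
    by (rule power2_le_imp_le) (use x y vnorm_nonneg in simp)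
qed

lemma vdist_eq: "\<lbrakk>x \<in> carrier S; y \<in> carrier S\<rbrakk> \<Longrightarrow> vdist S x y = vnorm S (vadd S x (vscale S (- 1) y))"
  by (simp add: vdist_def)

sublocale M: Metric_space "carrier S" "vdist S"
proof
  show "0 \<le> vdist S x y" for x y
    by (auto simp: vdist_def vclosed vnorm_nonneg)
  show "vdist S x y = vdist S y x" for x y
  proof (cases "x \<in> carrier S \<and> y \<in> carrier S")
    case True
    then have "vadd S x (vscale S (- 1) y) = vscale S (- 1) (vadd S y (vscale S (- 1) x))"
      by (intro vector_eqI) (auto simp: vclosed vinner_simps)
    with True show ?thesis by (simp add: vdist_eq vnorm_scale vclosed)
  qed (auto simp: vdist_def)
  show "vdist S x y = 0 \<longleftrightarrow> x = y" if "x \<in> carrier S" "y \<in> carrier S" for x y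
    using that vsub_eq_zero[of x y] vadd_uminus[of x] by (auto simp: vdist_eq vclosed vnorm_zero_iff)
  show "vdist S x z \<le> vdist S x y + vdist S y z"
    if "x \<in> carrier S" "y \<in> carrier S" "z \<in> carrier S" for x y z
  proof -
    have "vadd S x (vscale S (- 1) z) =
        vadd S (vadd S x (vscale S (- 1) y)) (vadd S y (vscale S (- 1) z))"
      using that by (intro vector_eqI) (auto simp: vclosed vinner_simps)
    then show ?thesis
      using that vnorm_triangle[of "vadd S x (vscale S (- 1) y)" "vadd S y (vscale S (- 1) z)"]
      by (simp add: vdist_eq vclosed)
  qed
qed

lemma vdist_add: "\<lbrakk>x \<in> carrier S; y \<in> carrier S; x' \<in> carrier S; y' \<in> carrier S\<rbrakk> \<Longrightarrow>
    vdist S (vadd S x y) (vadd S x' y') \<le> vdist S x x' + vdist S y y'"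
proof -
  assume *: "x \<in> carrier S" "y \<in> carrier S" "x' \<in> carrier S" "y' \<in> carrier S"
  have "vadd S (vadd S x y) (vscale S (- 1) (vadd S x' y')) =
      vadd S (vadd S x (vscale S (- 1) x')) (vadd S y (vscale S (- 1) y'))"
    using * by (intro vector_eqI) (auto simp: vclosed vinner_simps)
  then show ?thesis
    using * vnorm_triangle[of "vadd S x (vscale S (- 1) x')" "vadd S y (vscale S (- 1) y')"]
    by (simp add: vdist_eq vclosed)
qed

lemma vdist_scale: "\<lbrakk>x \<in> carrier S; y \<in> carrier S\<rbrakk> \<Longrightarrow>
    vdist S (vscale S c x) (vscale S c y) = cmod c * vdist S x y"
proof -
  assume *: "x \<in> carrier S" "y \<in> carrier S"
  have "vadd S (vscale S c x) (vscale S (- 1) (vscale S c y)) =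
      vscale S c (vadd S x (vscale S (- 1) y))"
    using * by (intro vector_eqI) (auto simp: vclosed vinner_simps algebra_simps)
  then show ?thesis using * by (simp add: vdist_eq vclosed vnorm_scale)
qed

lemma vnorm_diff_le: "\<lbrakk>x \<in> carrier S; y \<in> carrier S\<rbrakk> \<Longrightarrow> \<bar>vnorm S x - vnorm S y\<bar> \<le> vdist S x y"
proof -
  have *: "vnorm S x - vnorm S y \<le> vdist S x y" if "x \<in> carrier S" "y \<in> carrier S" for x y
  proof -
    have "x = vadd S (vadd S x (vscale S (- 1) y)) y"
      using that by (intro vector_eqI) (auto simp: vclosed vinner_simps)
    then have "vnorm S x = vnorm S (vadd S (vadd S x (vscale S (- 1) y)) y)" by (rule arg_cong)
    also have "\<dots> \<le> vnorm S (vadd S x (vscale S (- 1) y)) + vnorm S y"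
      using that by (intro vnorm_triangle vclosed)
    finally have "vnorm S x \<le> vnorm S (vadd S x (vscale S (- 1) y)) + vnorm S y" .
    then show ?thesis using that by (simp add: vdist_eq)
  qed
  assume "x \<in> carrier S" "y \<in> carrier S"
  with *[of x y] *[of y x] M.commute[of x y] show ?thesis by (simp add: abs_le_iff)
qed

lemma vdist_zero: "x \<in> carrier S \<Longrightarrow> vdist S x (vzero S) = vnorm S x"
proof -
  assume x: "x \<in> carrier S"
  then have "vadd S x (vscale S (- 1) (vzero S)) = x"
    by (intro vector_eqI) (auto simp: vclosed vinner_simps)
  then show ?thesis using x by (simp add: vdist_eq vclosed)
qed

lemma vinner_polar: "\<lbrakk>x \<in> carrier S; y \<in> carrier S\<rbrakk> \<Longrightarrow> vinner S x y = Complex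
    (((vnorm S (vadd S x y))\<^sup>2 - (vnorm S x)\<^sup>2 - (vnorm S y)\<^sup>2) / 2)
    (((vnorm S (vadd S x (vscale S (- \<i>) y)))\<^sup>2 - (vnorm S x)\<^sup>2 - (vnorm S y)\<^sup>2) / 2)"
  by (simp add: vnorm_add_sq vclosed vnorm_scale vinner_simps complex_eq_iff)

subsection \<open>The completion is a Hilbert space\<close>

lemma cauchy_seqsD: "x \<in> cauchy_seqs S \<Longrightarrow> x n \<in> carrier S"
  by (auto simp: cauchy_seqs_def M.MCauchy_def)

lemma cauchy_seqsI:
  assumes "\<And>n. x n \<in> carrier S" "\<And>e. 0 < e \<Longrightarrow> \<exists>N. \<forall>m\<ge>N. \<forall>n\<ge>N. vdist S (x m) (x n) < e"
  shows "x \<in> cauchy_seqs S"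
  using assms unfolding cauchy_seqs_def M.MCauchy_def by blast

lemma cauchy_seqsE:
  assumes "x \<in> cauchy_seqs S" "0 < e"
  obtains N where "\<And>m n. \<lbrakk>m \<ge> N; n \<ge> N\<rbrakk> \<Longrightarrow> vdist S (x m) (x n) < e"
  using assms unfolding cauchy_seqs_def M.MCauchy_def by blast

lemma cauchy_seqs_const: "a \<in> carrier S \<Longrightarrow> (\<lambda>n. a) \<in> cauchy_seqs S"
  by (rule cauchy_seqsI) auto

lemma cauchy_seqs_add:
  assumes x: "x \<in> cauchy_seqs S" and y: "y \<in> cauchy_seqs S"
  shows "(\<lambda>n. vadd S (x n) (y n)) \<in> cauchy_seqs S"
proof (rule cauchy_seqsI)
  show "vadd S (x n) (y n) \<in> carrier S" for n using x y cauchy_seqsD vadd_closed by blast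
  fix e :: real assume "0 < e"
  then have e: "0 < e / 2" by simp
  obtain N1 where N1: "\<And>m n. \<lbrakk>m \<ge> N1; n \<ge> N1\<rbrakk> \<Longrightarrow> vdist S (x m) (x n) < e / 2"
    using cauchy_seqsE[OF x e] by blast
  obtain N2 where N2: "\<And>m n. \<lbrakk>m \<ge> N2; n \<ge> N2\<rbrakk> \<Longrightarrow> vdist S (y m) (y n) < e / 2"
    using cauchy_seqsE[OF y e] by blast
  show "\<exists>N. \<forall>m\<ge>N. \<forall>n\<ge>N. vdist S (vadd S (x m) (y m)) (vadd S (x n) (y n)) < e"
  proof (intro exI allI impI)
    fix m n assume "max N1 N2 \<le> m" "max N1 N2 \<le> n"
    then have "vdist S (x m) (x n) < e / 2" "vdist S (y m) (y n) < e / 2" using N1 N2 by auto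
    moreover have "vdist S (vadd S (x m) (y m)) (vadd S (x n) (y n)) \<le> vdist S (x m) (x n) + vdist S (y m) (y n)"
      using vdist_add cauchy_seqsD[OF x] cauchy_seqsD[OF y] by blast
    ultimately show "vdist S (vadd S (x m) (y m)) (vadd S (x n) (y n)) < e" by argo
  qed
qed

lemma cauchy_seqs_image:
  assumes x: "x \<in> cauchy_seqs S" and T: "\<And>a. a \<in> carrier S \<Longrightarrow> T a \<in> carrier S"
    and L: "\<And>a b. \<lbrakk>a \<in> carrier S; b \<in> carrier S\<rbrakk> \<Longrightarrow> vdist S (T a) (T b) \<le> c * vdist S a b"
  shows "(\<lambda>n. T (x n)) \<in> cauchy_seqs S"
proof (rule cauchy_seqsI)
  show "T (x n) \<in> carrier S" for n using x cauchy_seqsD T by blast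
  fix e :: real assume e: "0 < e"
  define k where "k = max c 1"
  have k: "0 < k" "c \<le> k" by (auto simp: k_def)
  obtain N where N: "\<And>m n. \<lbrakk>m \<ge> N; n \<ge> N\<rbrakk> \<Longrightarrow> vdist S (x m) (x n) < e / k"
    using cauchy_seqsE[OF x] e k by (metis divide_pos_pos)
  show "\<exists>N. \<forall>m\<ge>N. \<forall>n\<ge>N. vdist S (T (x m)) (T (x n)) < e"
  proof (intro exI allI impI)
    fix m n assume "N \<le> m" "N \<le> n"
    then have "k * vdist S (x m) (x n) < e"
      using N[of m n] k by (simp add: pos_less_divide_eq mult.commute)
    moreover have "vdist S (T (x m)) (T (x n)) \<le> c * vdist S (x m) (x n)"
      using L cauchy_seqsD[OF x] by blast
    moreover have "c * vdist S (x m) (x n) \<le> k * vdist S (x m) (x n)"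
      using k by (intro mult_right_mono) auto
    ultimately show "vdist S (T (x m)) (T (x n)) < e" by linarith
  qed
qed

lemma cauchy_seqs_scale:
  "x \<in> cauchy_seqs S \<Longrightarrow> (\<lambda>n. vscale S c (x n)) \<in> cauchy_seqs S"
  by (rule cauchy_seqs_image[where c = "cmod c"]) (auto simp: vscale_closed vdist_scale)

lemma cauchy_equivD:
  assumes "(x, y) \<in> cauchy_equiv S"
  shows "x \<in> cauchy_seqs S" "y \<in> cauchy_seqs S" "(\<lambda>n. vdist S (x n) (y n)) \<longlonglongrightarrow> 0"
  using assms by (auto simp: cauchy_equiv_def)

lemma cauchy_equivI:
  assumes "x \<in> cauchy_seqs S" "y \<in> cauchy_seqs S" "(\<lambda>n. vdist S (x n) (y n)) \<longlonglongrightarrow> 0"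
  shows "(x, y) \<in> cauchy_equiv S"
  using assms by (auto simp: cauchy_equiv_def)

lemma tendsto_0_bounded:
  assumes "(f::nat \<Rightarrow> real) \<longlonglongrightarrow> 0" "\<And>n. 0 \<le> g n" "\<And>n. g n \<le> f n"
  shows "g \<longlonglongrightarrow> 0"
  using tendsto_sandwich[of "\<lambda>_. 0" g sequentially f 0] assms by simp

lemma cauchy_equiv_refl: "x \<in> cauchy_seqs S \<Longrightarrow> (x, x) \<in> cauchy_equiv S"
  by (rule cauchy_equivI) (auto simp: cauchy_seqsD)

lemma cauchy_equiv_sym: "(x, y) \<in> cauchy_equiv S \<Longrightarrow> (y, x) \<in> cauchy_equiv S"
  by (auto simp: cauchy_equiv_def M.commute)

lemma cauchy_equiv_trans:
  assumes "(x, y) \<in> cauchy_equiv S" "(y, z) \<in> cauchy_equiv S"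
  shows "(x, z) \<in> cauchy_equiv S"
proof (rule cauchy_equivI)
  note D = cauchy_equivD[OF assms(1)] cauchy_equivD[OF assms(2)]
  show "x \<in> cauchy_seqs S" "z \<in> cauchy_seqs S" using D by auto
  have "(\<lambda>n. vdist S (x n) (y n) + vdist S (y n) (z n)) \<longlonglongrightarrow> 0"
    using tendsto_add[OF D(3,6)] by simp
  then show "(\<lambda>n. vdist S (x n) (z n)) \<longlonglongrightarrow> 0"
    by (rule tendsto_0_bounded) (use D cauchy_seqsD M.triangle in auto)
qed

lemma cauchy_class_eq: "(x, y) \<in> cauchy_equiv S \<Longrightarrow> cauchy_class S x = cauchy_class S y"
  unfolding cauchy_class_def using cauchy_equiv_sym cauchy_equiv_trans by blast

lemma mem_cauchy_class: "y \<in> cauchy_class S x \<longleftrightarrow> (x, y) \<in> cauchy_equiv S"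
  by (simp add: cauchy_class_def)

lemma cauchy_class_self: "x \<in> cauchy_seqs S \<Longrightarrow> x \<in> cauchy_class S x"
  by (simp add: mem_cauchy_class cauchy_equiv_refl)

lemma carrier_completion: "X \<in> carrier (hilbert_completion S) \<longleftrightarrow> (\<exists>x\<in>cauchy_seqs S. X = cauchy_class S x)"
  by (auto simp: hilbert_completion_def quotient_def cauchy_class_def)

lemma cauchy_class_closed: "x \<in> cauchy_seqs S \<Longrightarrow> cauchy_class S x \<in> carrier (hilbert_completion S)"
  using carrier_completion by blast

lemma cauchy_equiv_add:
  assumes "(x, x') \<in> cauchy_equiv S" "(y, y') \<in> cauchy_equiv S"
  shows "((\<lambda>n. vadd S (x n) (y n)), (\<lambda>n. vadd S (x' n) (y' n))) \<in> cauchy_equiv S"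
proof (rule cauchy_equivI)
  note D = cauchy_equivD[OF assms(1)] cauchy_equivD[OF assms(2)]
  show "(\<lambda>n. vadd S (x n) (y n)) \<in> cauchy_seqs S" "(\<lambda>n. vadd S (x' n) (y' n)) \<in> cauchy_seqs S"
    using D cauchy_seqs_add by auto
  have "(\<lambda>n. vdist S (x n) (x' n) + vdist S (y n) (y' n)) \<longlonglongrightarrow> 0"
    using tendsto_add[OF D(3,6)] by simp
  then show "(\<lambda>n. vdist S (vadd S (x n) (y n)) (vadd S (x' n) (y' n))) \<longlonglongrightarrow> 0"
    by (rule tendsto_0_bounded) (use D cauchy_seqsD vdist_add in auto)
qed

lemma cauchy_equiv_image:
  assumes "(x, y) \<in> cauchy_equiv S" and T: "\<And>a. a \<in> carrier S \<Longrightarrow> T a \<in> carrier S"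
    and L: "\<And>a b. \<lbrakk>a \<in> carrier S; b \<in> carrier S\<rbrakk> \<Longrightarrow> vdist S (T a) (T b) \<le> c * vdist S a b"
  shows "((\<lambda>n. T (x n)), (\<lambda>n. T (y n))) \<in> cauchy_equiv S"
proof (rule cauchy_equivI)
  note D = cauchy_equivD[OF assms(1)]
  show "(\<lambda>n. T (x n)) \<in> cauchy_seqs S" "(\<lambda>n. T (y n)) \<in> cauchy_seqs S"
    using cauchy_seqs_image[OF D(1) T L] cauchy_seqs_image[OF D(2) T L] by auto
  have "(\<lambda>n. c * vdist S (x n) (y n)) \<longlonglongrightarrow> 0"
    using tendsto_mult_left[OF D(3), of c] by simp
  then show "(\<lambda>n. vdist S (T (x n)) (T (y n))) \<longlonglongrightarrow> 0"
    by (rule tendsto_0_bounded) (use D cauchy_seqsD L in auto)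
qed

lemma completion_image:
  assumes x: "x \<in> cauchy_seqs S" and T: "\<And>a. a \<in> carrier S \<Longrightarrow> T a \<in> carrier S"
    and L: "\<And>a b. \<lbrakk>a \<in> carrier S; b \<in> carrier S\<rbrakk> \<Longrightarrow> vdist S (T a) (T b) \<le> c * vdist S a b"
  shows "(\<Union>x'\<in>cauchy_class S x. cauchy_class S (\<lambda>n. T (x' n))) = cauchy_class S (\<lambda>n. T (x n))"
proof -
  have "cauchy_class S (\<lambda>n. T (x' n)) = cauchy_class S (\<lambda>n. T (x n))" if "x' \<in> cauchy_class S x" for x'
    using that unfolding mem_cauchy_class
    by (intro cauchy_class_eq cauchy_equiv_sym[OF cauchy_equiv_image[OF _ T L]])
  then show ?thesis using cauchy_class_self[OF x] by blast
qed

lemma C_scale: "x \<in> cauchy_seqs S \<Longrightarrow>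
    vscale (hilbert_completion S) c (cauchy_class S x) = cauchy_class S (\<lambda>n. vscale S c (x n))"
  using completion_image[of x "vscale S c" "cmod c"]
  by (simp add: hilbert_completion_def vscale_closed vdist_scale)

lemma C_add:
  assumes "x \<in> cauchy_seqs S" "y \<in> cauchy_seqs S"
  shows "vadd (hilbert_completion S) (cauchy_class S x) (cauchy_class S y) = cauchy_class S (\<lambda>n. vadd S (x n) (y n))"
proof -
  have "cauchy_class S (\<lambda>n. vadd S (x' n) (y' n)) = cauchy_class S (\<lambda>n. vadd S (x n) (y n))"
    if "x' \<in> cauchy_class S x" "y' \<in> cauchy_class S y" for x' y'
    using that unfolding mem_cauchy_class
    by (intro cauchy_class_eq cauchy_equiv_sym[OF cauchy_equiv_add])
  then have "(\<Union>x'\<in>cauchy_class S x. \<Union>y'\<in>cauchy_class S y. cauchy_class S (\<lambda>n. vadd S (x' n) (y' n))) =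
      (\<Union>x'\<in>cauchy_class S x. \<Union>y'\<in>cauchy_class S y. cauchy_class S (\<lambda>n. vadd S (x n) (y n)))"
    by (intro SUP_cong refl)
  also have "\<dots> = cauchy_class S (\<lambda>n. vadd S (x n) (y n))"
    using cauchy_class_self[OF assms(1)] cauchy_class_self[OF assms(2)]
    by (subst (1 2) SUP_const) auto
  finally show ?thesis by (simp add: hilbert_completion_def)
qed

lemma convergent_vnorm:
  assumes x: "x \<in> cauchy_seqs S"
  shows "convergent (\<lambda>n. vnorm S (x n))"
proof (rule Cauchy_convergent, rule metric_CauchyI)
  fix e :: real assume "0 < e"
  then obtain N where N: "\<And>m n. \<lbrakk>m \<ge> N; n \<ge> N\<rbrakk> \<Longrightarrow> vdist S (x m) (x n) < e"
    using cauchy_seqsE[OF x] by blast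
  then have "dist (vnorm S (x m)) (vnorm S (x n)) < e" if "m \<ge> N" "n \<ge> N" for m n
    using that vnorm_diff_le[OF cauchy_seqsD[OF x] cauchy_seqsD[OF x], of m n] N[of m n]
    unfolding dist_real_def by linarith
  then show "\<exists>M. \<forall>m\<ge>M. \<forall>n\<ge>M. dist (vnorm S (x m)) (vnorm S (x n)) < e" by blast
qed

lemma vnorm_equiv:
  assumes "(x, y) \<in> cauchy_equiv S" "(\<lambda>n. vnorm S (x n)) \<longlonglongrightarrow> c"
  shows "(\<lambda>n. vnorm S (y n)) \<longlonglongrightarrow> c"
proof -
  note D = cauchy_equivD[OF assms(1)]
  have "(\<lambda>n. \<bar>vnorm S (x n) - vnorm S (y n)\<bar>) \<longlonglongrightarrow> 0"
    by (rule tendsto_0_bounded[OF D(3)]) (use D cauchy_seqsD vnorm_diff_le in auto)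
  then have "(\<lambda>n. vnorm S (x n) - vnorm S (y n)) \<longlonglongrightarrow> 0" by (rule tendsto_rabs_zero_cancel)
  from tendsto_diff[OF assms(2) this] show ?thesis by simp
qed

lemma convergent_vinner:
  assumes x: "x \<in> cauchy_seqs S" and y: "y \<in> cauchy_seqs S"
  obtains c where "(\<lambda>n. vinner S (x n) (y n)) \<longlonglongrightarrow> c"
    and "\<And>x' y'. \<lbrakk>(x, x') \<in> cauchy_equiv S; (y, y') \<in> cauchy_equiv S\<rbrakk> \<Longrightarrow>
      (\<lambda>n. vinner S (x' n) (y' n)) \<longlonglongrightarrow> c"
proof -
  note iy = cauchy_seqs_scale[OF y, of "- \<i>"]
  obtain a b c d where lims: "(\<lambda>n. vnorm S (x n)) \<longlonglongrightarrow> a" "(\<lambda>n. vnorm S (y n)) \<longlonglongrightarrow> b"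
      "(\<lambda>n. vnorm S (vadd S (x n) (y n))) \<longlonglongrightarrow> c"
      "(\<lambda>n. vnorm S (vadd S (x n) (vscale S (- \<i>) (y n)))) \<longlonglongrightarrow> d"
    using convergent_vnorm[OF x] convergent_vnorm[OF y] convergent_vnorm[OF cauchy_seqs_add[OF x y]]
      convergent_vnorm[OF cauchy_seqs_add[OF x iy]] unfolding convergent_def by auto
  define l where "l = Complex ((c\<^sup>2 - a\<^sup>2 - b\<^sup>2) / 2) ((d\<^sup>2 - a\<^sup>2 - b\<^sup>2) / 2)"
  have *: "(\<lambda>n. vinner S (x' n) (y' n)) \<longlonglongrightarrow> l"
    if "(x, x') \<in> cauchy_equiv S" "(y, y') \<in> cauchy_equiv S" for x' y'
  proof -
    have iy': "((\<lambda>n. vscale S (- \<i>) (y n)), (\<lambda>n. vscale S (- \<i>) (y' n))) \<in> cauchy_equiv S"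
      by (rule cauchy_equiv_image[where c = 1, OF that(2)]) (auto simp: vscale_closed vdist_scale)
    have "(\<lambda>n. Complex
        (((vnorm S (vadd S (x' n) (y' n)))\<^sup>2 - (vnorm S (x' n))\<^sup>2 - (vnorm S (y' n))\<^sup>2) / 2)
        (((vnorm S (vadd S (x' n) (vscale S (- \<i>) (y' n))))\<^sup>2 - (vnorm S (x' n))\<^sup>2 - (vnorm S (y' n))\<^sup>2) / 2))
        \<longlonglongrightarrow> l"
      unfolding l_def
      by (intro tendsto_Complex tendsto_divide tendsto_diff tendsto_power tendsto_const)
         (use vnorm_equiv[OF that(1) lims(1)] vnorm_equiv[OF that(2) lims(2)]
            vnorm_equiv[OF cauchy_equiv_add[OF that] lims(3)]
            vnorm_equiv[OF cauchy_equiv_add[OF that(1) iy'] lims(4)] in simp_all)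
    moreover have "x' n \<in> carrier S" "y' n \<in> carrier S" for n
      using that cauchy_equivD(2) cauchy_seqsD by blast+
    ultimately show ?thesis by (simp only: vinner_polar)
  qed
  show ?thesis by (rule that[OF *[OF cauchy_equiv_refl[OF x] cauchy_equiv_refl[OF y]] *])
qed

lemma C_inner:
  assumes x: "x \<in> cauchy_seqs S" and y: "y \<in> cauchy_seqs S"
  shows "(\<lambda>n. vinner S (x n) (y n)) \<longlonglongrightarrow> vinner (hilbert_completion S) (cauchy_class S x) (cauchy_class S y)"
proof -
  obtain c where c: "(\<lambda>n. vinner S (x n) (y n)) \<longlonglongrightarrow> c"
    and c': "\<And>x' y'. \<lbrakk>(x, x') \<in> cauchy_equiv S; (y, y') \<in> cauchy_equiv S\<rbrakk> \<Longrightarrow>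
      (\<lambda>n. vinner S (x' n) (y' n)) \<longlonglongrightarrow> c"
    using convergent_vinner[OF assms] by blast
  have "vinner (hilbert_completion S) (cauchy_class S x) (cauchy_class S y) = c"
    unfolding hilbert_completion_def inner_space.simps
  proof (rule the_equality)
    show "\<exists>x\<in>cauchy_class S x. \<exists>y\<in>cauchy_class S y. (\<lambda>n. vinner S (x n) (y n)) \<longlonglongrightarrow> c"
      by (intro bexI[OF _ cauchy_class_self[OF x]] bexI[OF _ cauchy_class_self[OF y]] c)
    show "l = c" if "\<exists>x\<in>cauchy_class S x. \<exists>y\<in>cauchy_class S y. (\<lambda>n. vinner S (x n) (y n)) \<longlonglongrightarrow> l" for l
    proof -
      note l = that
      obtain x' y' where "(x, x') \<in> cauchy_equiv S" "(y, y') \<in> cauchy_equiv S"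
          "(\<lambda>n. vinner S (x' n) (y' n)) \<longlonglongrightarrow> l"
        using l by (auto simp: mem_cauchy_class)
      then show ?thesis using c' LIMSEQ_unique by blast
    qed
  qed
  with c show ?thesis by simp
qed

lemma C_zero: "vzero (hilbert_completion S) = cauchy_class S (\<lambda>n. vzero S)"
  by (simp add: hilbert_completion_def)

lemma C_norm:
  assumes x: "x \<in> cauchy_seqs S"
  shows "(\<lambda>n. vnorm S (x n)) \<longlonglongrightarrow> vnorm (hilbert_completion S) (cauchy_class S x)"
  unfolding vnorm_def by (intro tendsto_real_sqrt tendsto_Re C_inner x)

lemma C_dist:
  assumes x: "x \<in> cauchy_seqs S" and y: "y \<in> cauchy_seqs S"
  shows "(\<lambda>n. vdist S (x n) (y n)) \<longlonglongrightarrow> vdist (hilbert_completion S) (cauchy_class S x) (cauchy_class S y)"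
proof -
  have m: "(\<lambda>n. vscale S (- 1) (y n)) \<in> cauchy_seqs S" by (rule cauchy_seqs_scale[OF y])
  have "vdist (hilbert_completion S) (cauchy_class S x) (cauchy_class S y) =
      vnorm (hilbert_completion S) (cauchy_class S (\<lambda>n. vadd S (x n) (vscale S (- 1) (y n))))"
    using x y m by (simp add: vdist_def cauchy_class_closed C_scale C_add)
  moreover have "vdist S (x n) (y n) = vnorm S (vadd S (x n) (vscale S (- 1) (y n)))" for n
    using x y cauchy_seqsD vdist_eq by blast
  ultimately show ?thesis using C_norm[OF cauchy_seqs_add[OF x m]] by simp
qed

lemma complex_inner_space_completion: "complex_inner_space (hilbert_completion S)"
proof
  fix X Y Z :: "(nat \<Rightarrow> 'v) set" and c d :: complex
  assume "X \<in> carrier (hilbert_completion S)"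
  then obtain x where x: "x \<in> cauchy_seqs S" and X: "X = cauchy_class S x"
    using carrier_completion by blast
  note xc = cauchy_seqsD[OF x]
  note sx = cauchy_seqs_scale[OF x]
  note zz = cauchy_seqs_const[OF vzero_closed]
  show "vscale (hilbert_completion S) c X \<in> carrier (hilbert_completion S)" unfolding X using x sx by (simp add: C_scale cauchy_class_closed)
  show "vadd (hilbert_completion S) X (vzero (hilbert_completion S)) = X" unfolding X C_zero using x zz xc by (simp add: C_add vadd_zero)
  show "vadd (hilbert_completion S) X (vscale (hilbert_completion S) (- 1) X) = vzero (hilbert_completion S)"
    unfolding X C_zero using x sx xc by (simp add: C_scale C_add vadd_uminus)
  show "vscale (hilbert_completion S) (c + d) X = vadd (hilbert_completion S) (vscale (hilbert_completion S) c X) (vscale (hilbert_completion S) d X)"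
    unfolding X using x sx xc by (simp add: C_scale C_add vscale_add_left)
  show "vscale (hilbert_completion S) c (vscale (hilbert_completion S) d X) = vscale (hilbert_completion S) (c * d) X"
    unfolding X using x sx xc by (simp add: C_scale vscale_vscale)
  show "vscale (hilbert_completion S) 1 X = X" unfolding X using x xc by (simp add: C_scale vscale_one)
  show "0 \<le> Re (vinner (hilbert_completion S) X X)"
    unfolding X using tendsto_Re[OF C_inner[OF x x]]
    by (rule LIMSEQ_le_const) (use vinner_pos xc in blast)
  show "X = vzero (hilbert_completion S)" if "vinner (hilbert_completion S) X X = 0"
  proof -
    have "(\<lambda>n. vnorm S (x n)) \<longlonglongrightarrow> 0"
      using C_norm[OF x] that unfolding X vnorm_def by simp
    then have "(\<lambda>n. vdist S (x n) (vzero S)) \<longlonglongrightarrow> 0" using xc by (simp add: vdist_zero)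
    then show ?thesis unfolding X C_zero by (intro cauchy_class_eq cauchy_equivI x zz)
  qed
  assume "Y \<in> carrier (hilbert_completion S)"
  then obtain y where y: "y \<in> cauchy_seqs S" and Y: "Y = cauchy_class S y"
    using carrier_completion by blast
  note yc = cauchy_seqsD[OF y]
  note sy = cauchy_seqs_scale[OF y]
  note xy = cauchy_seqs_add[OF x y]
  show "vadd (hilbert_completion S) X Y \<in> carrier (hilbert_completion S)" unfolding X Y using x y xy by (simp add: C_add cauchy_class_closed)
  show "vadd (hilbert_completion S) X Y = vadd (hilbert_completion S) Y X" unfolding X Y using x y xc yc by (simp add: C_add vadd_commute)
  show "vscale (hilbert_completion S) c (vadd (hilbert_completion S) X Y) = vadd (hilbert_completion S) (vscale (hilbert_completion S) c X) (vscale (hilbert_completion S) c Y)"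
    unfolding X Y using x y xy sx sy xc yc by (simp add: C_add C_scale vscale_add_right)
  show "vinner (hilbert_completion S) X Y = cnj (vinner (hilbert_completion S) Y X)"
  proof (rule LIMSEQ_unique)
    show "(\<lambda>n. vinner S (x n) (y n)) \<longlonglongrightarrow> vinner (hilbert_completion S) X Y" unfolding X Y by (rule C_inner[OF x y])
    have "(\<lambda>n. cnj (vinner S (y n) (x n))) \<longlonglongrightarrow> cnj (vinner (hilbert_completion S) Y X)"
      unfolding X Y by (intro tendsto_cnj C_inner x y)
    then show "(\<lambda>n. vinner S (x n) (y n)) \<longlonglongrightarrow> cnj (vinner (hilbert_completion S) Y X)"
      by (simp only: vinner_commute[OF xc yc])
  qed
  show "vinner (hilbert_completion S) X (vscale (hilbert_completion S) c Y) = c * vinner (hilbert_completion S) X Y"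
  proof (rule LIMSEQ_unique)
    show "(\<lambda>n. vinner S (x n) (vscale S c (y n))) \<longlonglongrightarrow> vinner (hilbert_completion S) X (vscale (hilbert_completion S) c Y)"
      unfolding X Y C_scale[OF y] by (rule C_inner[OF x sy])
    have "(\<lambda>n. c * vinner S (x n) (y n)) \<longlonglongrightarrow> c * vinner (hilbert_completion S) X Y"
      unfolding X Y by (intro tendsto_mult tendsto_const C_inner x y)
    then show "(\<lambda>n. vinner S (x n) (vscale S c (y n))) \<longlonglongrightarrow> c * vinner (hilbert_completion S) X Y"
      using xc yc by (simp add: vinner_scale_right)
  qed
  assume "Z \<in> carrier (hilbert_completion S)"
  then obtain z where z: "z \<in> cauchy_seqs S" and Z: "Z = cauchy_class S z"
    using carrier_completion by blast
  note zc = cauchy_seqsD[OF z]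
  note yz = cauchy_seqs_add[OF y z]
  show "vadd (hilbert_completion S) (vadd (hilbert_completion S) X Y) Z = vadd (hilbert_completion S) X (vadd (hilbert_completion S) Y Z)"
    unfolding X Y Z using x y z xy yz xc yc zc by (simp add: C_add vadd_assoc)
  show "vinner (hilbert_completion S) X (vadd (hilbert_completion S) Y Z) = vinner (hilbert_completion S) X Y + vinner (hilbert_completion S) X Z"
  proof (rule LIMSEQ_unique)
    show "(\<lambda>n. vinner S (x n) (vadd S (y n) (z n))) \<longlonglongrightarrow> vinner (hilbert_completion S) X (vadd (hilbert_completion S) Y Z)"
      unfolding X Y Z C_add[OF y z] by (rule C_inner[OF x yz])
    have "(\<lambda>n. vinner S (x n) (y n) + vinner S (x n) (z n)) \<longlonglongrightarrow> vinner (hilbert_completion S) X Y + vinner (hilbert_completion S) X Z"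
      unfolding X Y Z by (intro tendsto_add C_inner x y z)
    then show "(\<lambda>n. vinner S (x n) (vadd S (y n) (z n))) \<longlonglongrightarrow> vinner (hilbert_completion S) X Y + vinner (hilbert_completion S) X Z"
      using xc yc zc by (simp add: vinner_add_right)
  qed
next
  show "vzero (hilbert_completion S) \<in> carrier (hilbert_completion S)"
    unfolding C_zero by (intro cauchy_class_closed cauchy_seqs_const vzero_closed)
qed

abbreviation "const_class a \<equiv> cauchy_class S (\<lambda>n. a)"

lemma const_class_dist:
  assumes "a \<in> carrier S" "b \<in> carrier S"
  shows "vdist (hilbert_completion S) (const_class a) (const_class b) = vdist S a b"
  using C_dist[OF cauchy_seqs_const[OF assms(1)] cauchy_seqs_const[OF assms(2)]]
  by (metis LIMSEQ_unique tendsto_const)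

lemma const_class_approx:
  assumes x: "x \<in> cauchy_seqs S" and "0 < e"
  obtains N where "\<And>k. k \<ge> N \<Longrightarrow> vdist (hilbert_completion S) (const_class (x k)) (cauchy_class S x) \<le> e"
proof -
  obtain N where N: "\<And>m n. \<lbrakk>m \<ge> N; n \<ge> N\<rbrakk> \<Longrightarrow> vdist S (x m) (x n) < e"
    using cauchy_seqsE[OF assms] by blast
  have "vdist (hilbert_completion S) (const_class (x k)) (cauchy_class S x) \<le> e" if "k \<ge> N" for k
  proof (rule LIMSEQ_le_const2[OF C_dist])
    show "\<exists>M. \<forall>n\<ge>M. vdist S (x k) (x n) \<le> e" using N that less_imp_le by blast
  qed (use x cauchy_seqsD cauchy_seqs_const in auto)
  then show ?thesis using that by blast
qed

theorem hilbert_space_completion: "hilbert_space (hilbert_completion S)"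
proof -
  interpret C: complex_inner_space "hilbert_completion S" by (rule complex_inner_space_completion)
  have "C.M.mcomplete"
    unfolding C.M.mcomplete_def
  proof (intro allI impI)
    fix X assume X: "C.M.MCauchy X"
    then have XC: "X k \<in> carrier (hilbert_completion S)" for k by (auto simp: C.M.MCauchy_def)
    have "\<exists>a\<in>carrier S. vdist (hilbert_completion S) (const_class a) (X k) \<le> inverse (real (Suc k))" for k
    proof -
      obtain x where x: "x \<in> cauchy_seqs S" "X k = cauchy_class S x"
        using XC carrier_completion by blast
      have "0 < inverse (real (Suc k))" by simp
      from const_class_approx[OF x(1) this] show ?thesis
        using x cauchy_seqsD[OF x(1)] by (metis order_refl)
    qed
    then obtain y where y: "\<And>k. y k \<in> carrier S"
      and yX: "\<And>k. vdist (hilbert_completion S) (const_class (y k)) (X k) \<le> inverse (real (Suc k))" by metis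
    have cc: "const_class (y k) \<in> carrier (hilbert_completion S)" for k
      by (intro cauchy_class_closed cauchy_seqs_const y)
    have small: "\<exists>N. \<forall>k\<ge>N. inverse (real (Suc k)) < e" if e: "0 < e" for e :: real
      using LIMSEQ_inverse_real_of_nat e by (auto simp: eventually_sequentially dest!: order_tendstoD(2))
    have yC: "y \<in> cauchy_seqs S"
    proof (rule cauchy_seqsI[OF y])
      fix e :: real assume e: "0 < e"
      then have e3: "0 < e / 3" by simp
      obtain N1 where N1: "\<And>k. k \<ge> N1 \<Longrightarrow> inverse (real (Suc k)) < e / 3" using small[OF e3] by blast
      obtain N2 where N2: "\<And>m n. \<lbrakk>m \<ge> N2; n \<ge> N2\<rbrakk> \<Longrightarrow> vdist (hilbert_completion S) (X m) (X n) < e / 3"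
        using X e3 unfolding C.M.MCauchy_def by blast
      show "\<exists>N. \<forall>m\<ge>N. \<forall>n\<ge>N. vdist S (y m) (y n) < e"
      proof (intro exI allI impI)
        fix m n assume mn: "max N1 N2 \<le> m" "max N1 N2 \<le> n"
        have "vdist S (y m) (y n) = vdist (hilbert_completion S) (const_class (y m)) (const_class (y n))"
          using const_class_dist[OF y y] by simp
        also have "\<dots> \<le> vdist (hilbert_completion S) (const_class (y m)) (X m) + vdist (hilbert_completion S) (X m) (const_class (y n))"
          by (rule C.M.triangle[OF cc XC cc])
        also have "vdist (hilbert_completion S) (X m) (const_class (y n)) \<le> vdist (hilbert_completion S) (X m) (X n) + vdist (hilbert_completion S) (X n) (const_class (y n))"
          by (rule C.M.triangle[OF XC XC cc])
        finally show "vdist S (y m) (y n) < e"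
          using yX[of m] yX[of n] C.M.commute[of "X n" "const_class (y n)"] N1[of m] N1[of n] N2[of m n] mn
          by simp
      qed
    qed
    let ?l = "cauchy_class S y"
    have lC: "?l \<in> carrier (hilbert_completion S)" by (rule cauchy_class_closed[OF yC])
    have "limitin C.M.mtopology X ?l sequentially"
      unfolding C.M.limit_metric_sequentially
    proof (intro conjI lC allI impI)
      fix e :: real assume e: "0 < e"
      then have e2: "0 < e / 2" by simp
      obtain N1 where N1: "\<And>k. k \<ge> N1 \<Longrightarrow> inverse (real (Suc k)) < e / 2" using small[OF e2] by blast
      obtain N2 where N2: "\<And>k. k \<ge> N2 \<Longrightarrow> vdist (hilbert_completion S) (const_class (y k)) ?l \<le> e / 2"
        using const_class_approx[OF yC e2] by blast
      show "\<exists>N. \<forall>n\<ge>N. X n \<in> carrier (hilbert_completion S) \<and> vdist (hilbert_completion S) (X n) ?l < e"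
      proof (intro exI allI impI conjI XC)
        fix n assume n: "max N1 N2 \<le> n"
        have "vdist (hilbert_completion S) (X n) ?l \<le> vdist (hilbert_completion S) (X n) (const_class (y n)) + vdist (hilbert_completion S) (const_class (y n)) ?l"
          by (rule C.M.triangle[OF XC cc lC])
        then show "vdist (hilbert_completion S) (X n) ?l < e"
          using yX[of n] C.M.commute[of "X n" "const_class (y n)"] N1[of n] N2[of n] n by simp
      qed
    qed
    then show "\<exists>l. limitin C.M.mtopology X l sequentially" by blast
  qed
  then show ?thesis by unfold_locales
qed

end

context complex_inner_space
begin

context
  fixes T :: "'v \<Rightarrow> 'v"
  assumes T_closed: "\<And>a. a \<in> carrier S \<Longrightarrow> T a \<in> carrier S"
    and T_add: "\<And>a b. \<lbrakk>a \<in> carrier S; b \<in> carrier S\<rbrakk> \<Longrightarrow> T (vadd S a b) = vadd S (T a) (T b)"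
    and T_scale: "\<And>c a. a \<in> carrier S \<Longrightarrow> T (vscale S c a) = vscale S c (T a)"
    and T_inner: "\<And>a b. \<lbrakk>a \<in> carrier S; b \<in> carrier S\<rbrakk> \<Longrightarrow> vinner S (T a) (T b) = vinner S a b"
begin

lemma T_dist: "\<lbrakk>a \<in> carrier S; b \<in> carrier S\<rbrakk> \<Longrightarrow> vdist S (T a) (T b) \<le> 1 * vdist S a b"
proof -
  assume a: "a \<in> carrier S" and b: "b \<in> carrier S"
  let ?w = "vadd S a (vscale S (- 1) b)"
  have w: "?w \<in> carrier S" using a b by (simp add: vclosed)
  have "vadd S (T a) (vscale S (- 1) (T b)) = T ?w"
    using a b by (simp add: T_add T_scale vclosed)
  then show ?thesis using a b w by (simp add: vdist_eq T_closed vnorm_def T_inner)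
qed

lemma T_seq: "x \<in> cauchy_seqs S \<Longrightarrow> (\<lambda>n. T (x n)) \<in> cauchy_seqs S"
  by (rule cauchy_seqs_image[OF _ T_closed T_dist])

lemma completion_map_class:
  "x \<in> cauchy_seqs S \<Longrightarrow> completion_map S T (cauchy_class S x) = cauchy_class S (\<lambda>n. T (x n))"
  unfolding completion_map_def by (rule completion_image[OF _ T_closed T_dist])

lemma completion_map_closed:
  "X \<in> carrier (hilbert_completion S) \<Longrightarrow> completion_map S T X \<in> carrier (hilbert_completion S)"
  using carrier_completion completion_map_class T_seq by auto

lemma completion_map_add:
  assumes "X \<in> carrier (hilbert_completion S)" "Y \<in> carrier (hilbert_completion S)"
  shows "completion_map S T (vadd (hilbert_completion S) X Y) =
    vadd (hilbert_completion S) (completion_map S T X) (completion_map S T Y)"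
proof -
  obtain x y where x: "x \<in> cauchy_seqs S" "X = cauchy_class S x"
    and y: "y \<in> cauchy_seqs S" "Y = cauchy_class S y"
    using assms carrier_completion by auto
  show ?thesis
    using x y T_seq[OF x(1)] T_seq[OF y(1)] cauchy_seqs_add[OF x(1) y(1)]
      cauchy_seqsD[OF x(1)] cauchy_seqsD[OF y(1)]
    by (simp add: C_add completion_map_class T_add)
qed

lemma completion_map_scale:
  assumes "X \<in> carrier (hilbert_completion S)"
  shows "completion_map S T (vscale (hilbert_completion S) c X) =
    vscale (hilbert_completion S) c (completion_map S T X)"
proof -
  obtain x where x: "x \<in> cauchy_seqs S" "X = cauchy_class S x"
    using assms carrier_completion by auto
  show ?thesis
    using x T_seq[OF x(1)] cauchy_seqs_scale[OF x(1)] cauchy_seqsD[OF x(1)]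
    by (simp add: C_scale completion_map_class T_scale)
qed

lemma completion_map_inner:
  assumes "X \<in> carrier (hilbert_completion S)" "Y \<in> carrier (hilbert_completion S)"
  shows "vinner (hilbert_completion S) (completion_map S T X) (completion_map S T Y) =
    vinner (hilbert_completion S) X Y"
proof -
  obtain x y where x: "x \<in> cauchy_seqs S" "X = cauchy_class S x"
    and y: "y \<in> cauchy_seqs S" "Y = cauchy_class S y"
    using assms carrier_completion by auto
  have "(\<lambda>n. vinner S (T (x n)) (T (y n))) = (\<lambda>n. vinner S (x n) (y n))"
    using cauchy_seqsD[OF x(1)] cauchy_seqsD[OF y(1)] T_inner by simp
  then show ?thesis
    using C_inner[OF T_seq[OF x(1)] T_seq[OF y(1)]] C_inner[OF x(1) y(1)] x y
    by (simp add: completion_map_class LIMSEQ_unique)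
qed

end

end

subsection \<open>The Pythagorean representation is a unitary representation\<close>

theorem hilbert_space_pyth_space:
  "pythagorean_pair A B \<Longrightarrow> hilbert_space (pyth_space A B)"
  unfolding pyth_space_def
  by (intro complex_inner_space.hilbert_space_completion complex_inner_space_direct_limit)

theorem pyth_rep_class:
  assumes AB: "pythagorean_pair A B" and "leaves t = leaves s" "length \<xi> = leaves s"
  shows "pyth_rep A B (F_class t s) (cauchy_class (direct_limit A B) (\<lambda>n. limit_class A B s \<xi>)) =
    cauchy_class (direct_limit A B) (\<lambda>n. limit_class A B t \<xi>)"
proof -
  interpret K: complex_inner_space "direct_limit A B"
    by (rule complex_inner_space_direct_limit[OF AB])
  have g: "F_class t s \<in> carrier thompson_F" using assms by (simp add: F_class_closed)
  have "(\<lambda>n. limit_class A B s \<xi>) \<in> cauchy_seqs (direct_limit A B)"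
    using assms by (intro K.cauchy_seqs_const limit_class_closed[OF AB])
  then show ?thesis
    unfolding pyth_rep_def
    using K.completion_map_class[where T = "limit_rep A B (F_class t s)", OF limit_rep_closed[OF AB g]
        limit_rep_add[OF AB g] limit_rep_scale[OF AB g] limit_rep_inner[OF AB g]]
    by (simp add: assms limit_rep_class)
qed

theorem unitary_representation_pyth_rep:
  assumes AB: "pythagorean_pair A B"
  shows "unitary_representation thompson_F (pyth_space A B) (pyth_rep A B)"
proof -
  interpret K: complex_inner_space "direct_limit A B"
    by (rule complex_inner_space_direct_limit[OF AB])
  interpret F: group thompson_F by (rule group_thompson_F)
  let ?C = "hilbert_completion (direct_limit A B)"
  have rep_class: "pyth_rep A B g (cauchy_class (direct_limit A B) x) =
      cauchy_class (direct_limit A B) (\<lambda>n. limit_rep A B g (x n))"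
    if "g \<in> carrier thompson_F" "x \<in> cauchy_seqs (direct_limit A B)" for g x
    unfolding pyth_rep_def
    using K.completion_map_class[where T = "limit_rep A B g", OF limit_rep_closed[OF AB that(1)]
      limit_rep_add[OF AB that(1)] limit_rep_scale[OF AB that(1)] limit_rep_inner[OF AB that(1)]] that by simp
  have closed: "pyth_rep A B g X \<in> carrier ?C" if "g \<in> carrier thompson_F" "X \<in> carrier ?C" for g X
    unfolding pyth_rep_def
    using K.completion_map_closed[where T = "limit_rep A B g", OF limit_rep_closed[OF AB that(1)]
      limit_rep_add[OF AB that(1)] limit_rep_scale[OF AB that(1)] limit_rep_inner[OF AB that(1)]] that by simp
  have mult: "pyth_rep A B (g \<otimes>\<^bsub>thompson_F\<^esub> h) X = pyth_rep A B g (pyth_rep A B h X)"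
    if gh: "g \<in> carrier thompson_F" "h \<in> carrier thompson_F" and X: "X \<in> carrier ?C" for g h X
  proof -
    obtain x where x: "x \<in> cauchy_seqs (direct_limit A B)" "X = cauchy_class (direct_limit A B) x"
      using X K.carrier_completion by auto
    have hx: "(\<lambda>n. limit_rep A B h (x n)) \<in> cauchy_seqs (direct_limit A B)"
      using K.T_seq[where T = "limit_rep A B h", OF limit_rep_closed[OF AB gh(2)]
      limit_rep_add[OF AB gh(2)] limit_rep_scale[OF AB gh(2)] limit_rep_inner[OF AB gh(2)]] x by simp
    show ?thesis
      using gh x hx K.cauchy_seqsD[OF x(1)] by (simp add: rep_class limit_rep_mult[OF AB])
  qed
  have one: "pyth_rep A B \<one>\<^bsub>thompson_F\<^esub> X = X" if X: "X \<in> carrier ?C" for X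
  proof -
    obtain x where x: "x \<in> cauchy_seqs (direct_limit A B)" "X = cauchy_class (direct_limit A B) x"
      using X K.carrier_completion by auto
    then show ?thesis
      using K.cauchy_seqsD[OF x(1)] by (simp add: rep_class limit_rep_one[OF AB])
  qed
  have "unitary_operator ?C (pyth_rep A B g)" if g: "g \<in> carrier thompson_F" for g
    unfolding unitary_operator_def
  proof (intro conjI ballI allI)
    show "bij_betw (pyth_rep A B g) (carrier ?C) (carrier ?C)"
    proof (rule bij_betwI[where g = "pyth_rep A B (inv\<^bsub>thompson_F\<^esub> g)"])
      show "pyth_rep A B g \<in> carrier ?C \<rightarrow> carrier ?C"
          "pyth_rep A B (inv\<^bsub>thompson_F\<^esub> g) \<in> carrier ?C \<rightarrow> carrier ?C"
        using g closed by auto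
      show "pyth_rep A B (inv\<^bsub>thompson_F\<^esub> g) (pyth_rep A B g X) = X" if "X \<in> carrier ?C" for X
        using mult[of "inv\<^bsub>thompson_F\<^esub> g" g X] g that one by simp
      show "pyth_rep A B g (pyth_rep A B (inv\<^bsub>thompson_F\<^esub> g) X) = X" if "X \<in> carrier ?C" for X
        using mult[of g "inv\<^bsub>thompson_F\<^esub> g" X] g that one by simp
    qed
  next
    fix X Y assume "X \<in> carrier ?C" "Y \<in> carrier ?C"
    then show "pyth_rep A B g (vadd ?C X Y) = vadd ?C (pyth_rep A B g X) (pyth_rep A B g Y)"
      unfolding pyth_rep_def
      using K.completion_map_add[where T = "limit_rep A B g", OF limit_rep_closed[OF AB g]
      limit_rep_add[OF AB g] limit_rep_scale[OF AB g] limit_rep_inner[OF AB g]] by simp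
  next
    fix c X assume "X \<in> carrier ?C"
    then show "pyth_rep A B g (vscale ?C c X) = vscale ?C c (pyth_rep A B g X)"
      unfolding pyth_rep_def
      using K.completion_map_scale[where T = "limit_rep A B g", OF limit_rep_closed[OF AB g]
      limit_rep_add[OF AB g] limit_rep_scale[OF AB g] limit_rep_inner[OF AB g]] by simp
  next
    fix X Y assume "X \<in> carrier ?C" "Y \<in> carrier ?C"
    then show "vinner ?C (pyth_rep A B g X) (pyth_rep A B g Y) = vinner ?C X Y"
      unfolding pyth_rep_def
      using K.completion_map_inner[where T = "limit_rep A B g", OF limit_rep_closed[OF AB g]
      limit_rep_add[OF AB g] limit_rep_scale[OF AB g] limit_rep_inner[OF AB g]] by simp
  qed
  with mult show ?thesis by (simp add: unitary_representation_def pyth_space_def)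
qed

end

theory Submission
  imports Defs
begin

text \<open>On a tree \<open>s\<close> that is deep at its two extreme leaves, the decorations of these leaves are of the
  form \<open>A\<^sup>n \<xi>\<close> and \<open>B\<^sup>n \<xi>\<close>, hence small. An element of \<open>F\<close> that maps all leaves of \<open>s\<close> but the last
  one into the first leaf therefore makes all matrix coefficients small. This yields a sequence \<open>g\<^sub>n\<close>
  in \<open>F\<close> with \<open>\<sigma>(g\<^sub>n) \<rightarrow> 0\<close> weakly. On a finite-dimensional subrepresentation weak convergence is norm
  convergence, and unitaries preserve norms, so the subrepresentation is zero.\<close>

section \<open>Weakly null sequences in inner product spaces\<close>

context complex_inner_space
begin

text \<open>Follows from the bound on the real part: multiplying \<open>y\<close> by a phase
  \<open>c\<close> of modulus 1 makes the inner product real and nonnegative without changing the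
  norm of \<open>y\<close>.\<close>

lemma cmod_vinner_le:
  assumes x: "x \<in> carrier S" and y: "y \<in> carrier S"
  shows "cmod (vinner S x y) \<le> vnorm S x * vnorm S y"
proof (cases "vinner S x y = 0")
  case True
  then show ?thesis using x y by (simp add: vnorm_nonneg)
next
  case False
  define c where "c = cnj (vinner S x y) / cmod (vinner S x y)"
  have "vinner S x (vscale S c y) = c * vinner S x y"
    using x y by (simp add: vinner_simps)
  also have "\<dots> = complex_of_real ((cmod (vinner S x y))\<^sup>2) / cmod (vinner S x y)"
    unfolding c_def times_divide_eq_left complex_norm_square by (simp only: mult.commute)
  also have "\<dots> = complex_of_real (cmod (vinner S x y))"
    using False by (simp add: power2_eq_square)
  finally have "cmod (vinner S x y) = Re (vinner S x (vscale S c y))" by simp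
  also have "\<dots> \<le> vnorm S x * vnorm S (vscale S c y)"
    using x y by (intro Re_vinner_le vclosed)
  also have "vnorm S (vscale S c y) = vnorm S y"
    using y False by (simp add: vnorm_scale c_def norm_divide)
  finally show ?thesis .
qed

text \<open>The existence of orthogonal projections is carried along because it provides the next
  Gram-Schmidt vector in the induction.\<close>

lemma finite_subset_tame_subspace:
  assumes "finite E" "E \<subseteq> carrier S"
  shows "\<exists>V. lin_subspace S V \<and> E \<subseteq> V \<and>
    (\<forall>v\<in>carrier S. \<exists>p\<in>V. \<forall>y\<in>V. vinner S y v = vinner S y p) \<and>
    (\<forall>x. (\<forall>n. x n \<in> V) \<longrightarrow> (\<forall>y\<in>V. (\<lambda>n. vinner S y (x n)) \<longlonglongrightarrow> 0) \<longrightarrow>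
      (\<lambda>n. vnorm S (x n)) \<longlonglongrightarrow> 0)"
  using assms
proof (induction E rule: finite_induct)
  case empty
  have "lin_subspace S {vzero S}"
    using vzero_closed by (auto simp: lin_subspace_def vadd_zero intro!: vector_eqI)
      (auto simp: vclosed vinner_simps)
  then show ?case
    by (intro exI[of _ "{vzero S}"]) (auto simp: vzero_closed)
next
  case (insert e E)
  then obtain V where V: "lin_subspace S V" and EV: "E \<subseteq> V"
    and proj: "\<And>v. v \<in> carrier S \<Longrightarrow> \<exists>p\<in>V. \<forall>y\<in>V. vinner S y v = vinner S y p"
    and null: "\<And>x. \<lbrakk>\<And>n. x n \<in> V; \<And>y. y \<in> V \<Longrightarrow> (\<lambda>n. vinner S y (x n)) \<longlonglongrightarrow> 0\<rbrakk> \<Longrightarrow>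
      (\<lambda>n. vnorm S (x n)) \<longlonglongrightarrow> 0"
    by auto
  have Vc: "x \<in> carrier S" if "x \<in> V" for x using V that by (auto simp: lin_subspace_def)
  have V0: "vzero S \<in> V" and Vadd: "\<And>x y. \<lbrakk>x \<in> V; y \<in> V\<rbrakk> \<Longrightarrow> vadd S x y \<in> V"
    and Vscale: "\<And>c x. x \<in> V \<Longrightarrow> vscale S c x \<in> V"
    using V by (auto simp: lin_subspace_def)
  have e: "e \<in> carrier S" using insert by simp
  obtain p where p: "p \<in> V" and pe: "\<And>y. y \<in> V \<Longrightarrow> vinner S y e = vinner S y p"
    using proj[OF e] by blast
  note pc = Vc[OF p]
  \<comment> \<open>Gram-Schmidt: \<open>q\<close> is the component of \<open>e\<close> orthogonal
    to \<open>V\<close>. It may be zero, namely when \<open>e\<close> already lies in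
    \<open>V\<close>.\<close>
  define q where "q = vadd S e (vscale S (-1) p)"
  have q: "q \<in> carrier S" using e pc by (simp add: q_def vclosed)
  have yq: "vinner S y q = 0" if "y \<in> V" for y
    using that Vc[OF that] e pc pe by (simp add: q_def vclosed vinner_simps)
  have qy: "vinner S q y = 0" if "y \<in> V" for y
    using vinner_commute[OF q Vc[OF that]] yq[OF that] by simp
  \<comment> \<open>\<open>W\<close> is the orthogonal sum of \<open>V\<close> and the line through
    \<open>q\<close>.\<close>
  define W where "W = {vadd S y (vscale S c q) | y c. y \<in> V}"
  have WI: "vadd S y (vscale S c q) \<in> W" if "y \<in> V" for y c using that by (auto simp: W_def)
  have eq: "e = vadd S p (vscale S 1 q)"
    using e pc q by (intro vector_eqI) (auto simp: q_def vclosed vinner_simps)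
  have VW: "y = vadd S y (vscale S 0 q)" if "y \<in> V" for y
    using q Vc[OF that] by (intro vector_eqI) (auto simp: vclosed vinner_simps)
  have "lin_subspace S W"
    unfolding lin_subspace_def
  proof (intro conjI ballI allI)
    show "W \<subseteq> carrier S" using q Vc by (auto simp: W_def vclosed)
    show "vzero S \<in> W" using WI[OF V0, of 0] VW[OF V0] by simp
  next
    fix x y assume "x \<in> W" "y \<in> W"
    then obtain x' c y' d where *: "x' \<in> V" "y' \<in> V" "x = vadd S x' (vscale S c q)" "y = vadd S y' (vscale S d q)"
      by (auto simp: W_def)
    have "vadd S x y = vadd S (vadd S x' y') (vscale S (c + d) q)"
      using * q Vc by (intro vector_eqI) (auto simp: vclosed vinner_simps algebra_simps)
    then show "vadd S x y \<in> W" using WI Vadd * by simp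
  next
    fix c x assume "x \<in> W"
    then obtain x' d where *: "x' \<in> V" "x = vadd S x' (vscale S d q)"
      by (auto simp: W_def)
    have "vscale S c x = vadd S (vscale S c x') (vscale S (c * d) q)"
      using * q Vc by (intro vector_eqI) (auto simp: vclosed vinner_simps algebra_simps)
    then show "vscale S c x \<in> W" using WI Vscale * by simp
  qed
  moreover have "insert e E \<subseteq> W"
    using WI[OF p, of 1] eq EV WI[of _ 0] VW by auto
  moreover have "\<exists>r\<in>W. \<forall>y\<in>W. vinner S y v = vinner S y r" if v: "v \<in> carrier S" for v
  proof -
    obtain r where r: "r \<in> V" and rv: "\<And>y. y \<in> V \<Longrightarrow> vinner S y v = vinner S y r"
      using proj[OF v] by blast
    \<comment> \<open>The Fourier coefficient of \<open>v\<close> along \<open>q\<close>. If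
      \<open>q\<close> is zero, division by zero gives \<open>a = 0\<close>, and the identity below
      still holds because both of its sides vanish.\<close>
    define a where "a = vinner S q v / vinner S q q"
    have a: "a * vinner S q q = vinner S q v"
    proof (cases "vinner S q q = 0")
      case True
      then have "q = vzero S" using vinner_definite q by blast
      then show ?thesis using v True by simp
    qed (simp add: a_def)
    have "vinner S y v = vinner S y (vadd S r (vscale S a q))" if yW: "y \<in> W" for y
    proof -
      obtain y' c where y: "y' \<in> V" "y = vadd S y' (vscale S c q)" using yW by (auto simp: W_def)
      show ?thesis
        using y Vc[OF y(1)] Vc[OF r] q v rv[OF y(1)] yq[OF y(1)] qy[OF r] a
        by (simp add: vclosed vinner_simps)
    qed
    then show ?thesis using WI[OF r] by blast
  qed
  moreover have "(\<lambda>n. vnorm S (x n)) \<longlonglongrightarrow> 0"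
    if xW: "\<forall>n. x n \<in> W" and weak: "\<forall>y\<in>W. (\<lambda>n. vinner S y (x n)) \<longlonglongrightarrow> 0" for x
  proof -
    have "\<forall>n. \<exists>y c. y \<in> V \<and> x n = vadd S y (vscale S c q)" using xW unfolding W_def by blast
    then obtain y c where y: "\<And>n. y n \<in> V" and x: "\<And>n. x n = vadd S (y n) (vscale S (c n) q)"
      by metis
    have "(\<lambda>n. vinner S u (y n)) \<longlonglongrightarrow> 0" if u: "u \<in> V" for u
    proof -
      have "vinner S u (x n) = vinner S u (y n)" for n
        using u Vc[OF u] Vc[OF y[of n]] q yq[OF u] by (simp add: x vclosed vinner_simps)
      then show ?thesis using bspec[OF weak, of u] WI[OF u, of 0] VW[OF u] by simp
    qed
    then have ynull: "(\<lambda>n. vnorm S (y n)) \<longlonglongrightarrow> 0" by (rule null[OF y])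
    \<comment> \<open>The claim is about the product because for \<open>q = 0\<close> the
      coefficients \<open>c n\<close> are arbitrary. Otherwise testing \<open>x n\<close> against
      \<open>q\<close> isolates \<open>c n\<close>, since \<open>y n\<close> is orthogonal to
      \<open>q\<close>.\<close>
    have qnull: "(\<lambda>n. cmod (c n) * vnorm S q) \<longlonglongrightarrow> 0"
    proof (cases "q = vzero S")
      case False
      then have n0: "vnorm S q \<noteq> 0" using vnorm_zero_iff q by blast
      have "q = vadd S (vzero S) (vscale S 1 q)"
        using q by (intro vector_eqI) (auto simp: vclosed vinner_simps)
      then have "q \<in> W" using WI[OF V0] by metis
      then have "(\<lambda>n. vinner S q (x n)) \<longlonglongrightarrow> 0" using weak by blast
      then have "(\<lambda>n. cmod (vinner S q (x n)) / vnorm S q) \<longlonglongrightarrow> 0"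
        by (intro tendsto_divide_zero tendsto_norm_zero)
      moreover have "cmod (vinner S q (x n)) / vnorm S q = cmod (c n) * vnorm S q" for n
      proof -
        have "vinner S q (x n) = c n * vinner S q q"
          using q Vc[OF y[of n]] qy[OF y[of n]] by (simp add: x vclosed vinner_simps)
        then show ?thesis using n0 q by (simp add: vinner_self norm_mult norm_power power2_eq_square vnorm_nonneg)
      qed
      ultimately show ?thesis by simp
    qed simp
    have "(\<lambda>n. vnorm S (y n) + cmod (c n) * vnorm S q) \<longlonglongrightarrow> 0"
      using tendsto_add[OF ynull qnull] by simp
    then show ?thesis
    proof (rule tendsto_0_bounded)
      show "0 \<le> vnorm S (x n)" for n using y Vc q by (simp add: x vclosed vnorm_nonneg)
      show "vnorm S (x n) \<le> vnorm S (y n) + cmod (c n) * vnorm S q" for n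
        using vnorm_triangle[of "y n" "vscale S (c n) q"] y Vc q by (simp add: x vclosed vnorm_scale)
    qed
  qed
  ultimately show ?case by blast
qed

text \<open>For \<open>z\<close> in a finite-dimensional subrepresentation, the vectors
  \<open>\<pi> (g n) z\<close> tend weakly to zero inside a tame subspace, hence in norm; but they
  all have the norm of \<open>z\<close>.\<close>

lemma weakly_mixingI:
  fixes G :: "('g, 'k) monoid_scheme"
  assumes rep: "unitary_representation G S \<pi>" and g: "\<And>n. g n \<in> carrier G"
    and weak: "\<And>x y. \<lbrakk>x \<in> carrier S; y \<in> carrier S\<rbrakk> \<Longrightarrow> (\<lambda>n. vinner S y (\<pi> (g n) x)) \<longlonglongrightarrow> 0"
  shows "weakly_mixing G S \<pi>"
  unfolding weakly_mixing_def
proof clarify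
  fix W assume sub: "subrepresentation G S \<pi> W" and fd: "finite_dimensional S W" and W0: "W \<noteq> {vzero S}"
  have W: "lin_subspace S W" and inv: "\<And>n x. x \<in> W \<Longrightarrow> \<pi> (g n) x \<in> W"
    using sub g by (auto simp: subrepresentation_def)
  obtain E where E: "finite E" "E \<subseteq> carrier S" "W = lin_subspace S hull E"
    using fd by (auto simp: finite_dimensional_def)
  obtain V where V: "lin_subspace S V" "E \<subseteq> V"
    and null: "\<And>x. \<lbrakk>\<And>n. x n \<in> V; \<And>y. y \<in> V \<Longrightarrow> (\<lambda>n. vinner S y (x n)) \<longlonglongrightarrow> 0\<rbrakk> \<Longrightarrow>
      (\<lambda>n. vnorm S (x n)) \<longlonglongrightarrow> 0"
    using finite_subset_tame_subspace[OF E(1,2)] by auto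
  \<comment> \<open>A hull is contained in every subspace containing its generators, so sequences in
    \<open>W\<close> inherit the convergence property of \<open>V\<close>.\<close>
  have WV: "W \<subseteq> V" unfolding E(3) using hull_minimal[of E V "lin_subspace S"] V by blast
  have Vc: "V \<subseteq> carrier S" using V by (simp add: lin_subspace_def)
  have "z = vzero S" if z: "z \<in> W" for z
  proof -
    have zc: "z \<in> carrier S" using z WV Vc by blast
    have "vnorm S (\<pi> (g n) z) = vnorm S z" for n
      using rep g zc by (auto simp: unitary_representation_def unitary_operator_def vnorm_def)
    moreover have "(\<lambda>n. vnorm S (\<pi> (g n) z)) \<longlonglongrightarrow> 0"
      by (rule null) (use inv[OF z] WV Vc weak[OF zc] in blast)+
    ultimately have "vnorm S z = 0" by (simp add: LIMSEQ_const_iff)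
    then show ?thesis using vnorm_zero_iff[OF zc] by simp
  qed
  then show False using W W0 by (auto simp: lin_subspace_def)
qed

text \<open>A three-epsilon argument: the operators \<open>U n\<close> preserve norms, so the errors
  of approximating \<open>x\<close> and \<open>y\<close> from \<open>D\<close> are bounded uniformly
  in \<open>n\<close>.\<close>

lemma weakly_null_isometries_from_dense:
  assumes U: "\<And>n. unitary_operator S (U n)" and D: "D \<subseteq> carrier S"
    and dense: "\<And>x e. \<lbrakk>x \<in> carrier S; 0 < e\<rbrakk> \<Longrightarrow> \<exists>a\<in>D. vdist S a x \<le> e"
    and weak: "\<And>a b. \<lbrakk>a \<in> D; b \<in> D\<rbrakk> \<Longrightarrow> (\<lambda>n. vinner S b (U n a)) \<longlonglongrightarrow> 0"
    and x: "x \<in> carrier S" and y: "y \<in> carrier S"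
  shows "(\<lambda>n. vinner S y (U n x)) \<longlonglongrightarrow> 0"
proof (rule LIMSEQ_I)
  fix e :: real assume e: "0 < e"
  have Uc: "U n z \<in> carrier S" if "z \<in> carrier S" for n z
    using U[of n] that by (auto simp: unitary_operator_def bij_betw_def)
  have Unorm: "vnorm S (U n z) = vnorm S z" if "z \<in> carrier S" for n z
    using U[of n] that by (auto simp: unitary_operator_def vnorm_def)
  have Udiff: "U n (vadd S z (vscale S (-1) z')) = vadd S (U n z) (vscale S (-1) (U n z'))"
    if "z \<in> carrier S" "z' \<in> carrier S" for n z z'
    using U[of n] that by (simp add: unitary_operator_def vclosed)
  \<comment> \<open>The order of choices matters: \<open>b\<close> is chosen with a tolerance
    depending on the norm of \<open>x\<close>, and only then \<open>a\<close> with a tolerance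
    depending on the norm of \<open>b\<close>. The summand 1 keeps the denominators
    positive.\<close>
  define d where "d = e / (3 * (vnorm S x + 1))"
  have d: "0 < d" "d * vnorm S x \<le> e / 3"
    using e vnorm_nonneg[OF x] by (auto simp: d_def field_simps)
  obtain b where b: "b \<in> D" "vdist S b y \<le> d" using dense[OF y d(1)] by blast
  have bc: "b \<in> carrier S" using b D by blast
  define d' where "d' = e / (3 * (vnorm S b + 1))"
  have d': "0 < d'" "vnorm S b * d' \<le> e / 3"
    using e vnorm_nonneg[OF bc] by (auto simp: d'_def field_simps)
  obtain a where a: "a \<in> D" "vdist S a x \<le> d'" using dense[OF x d'(1)] by blast
  have ac: "a \<in> carrier S" using a D by blast
  obtain N where N: "\<And>n. n \<ge> N \<Longrightarrow> cmod (vinner S b (U n a)) < e / 3"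
    using LIMSEQ_D[OF weak[OF a(1) b(1)], of "e / 3"] e by auto
  show "\<exists>N. \<forall>n\<ge>N. norm (vinner S y (U n x) - 0) < e"
  proof (intro exI allI impI)
    fix n assume n: "N \<le> n"
    let ?y = "vadd S b (vscale S (-1) y)" and ?x = "vadd S a (vscale S (-1) x)"
    have "vinner S y (U n x) = vinner S b (U n a) - vinner S b (U n ?x) - vinner S ?y (U n x)"
      using x y ac bc Uc[of _ n] by (simp add: Udiff vclosed vinner_simps)
    then have "cmod (vinner S y (U n x)) \<le>
        cmod (vinner S b (U n a)) + cmod (vinner S b (U n ?x)) + cmod (vinner S ?y (U n x))"
      by (metis norm_triangle_ineq4 add_right_mono order_trans)
    moreover have "cmod (vinner S b (U n ?x)) \<le> e / 3"
    proof -
      have "cmod (vinner S b (U n ?x)) \<le> vnorm S b * vnorm S ?x"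
        using cmod_vinner_le[of b "U n ?x"] bc ac x Uc Unorm by (simp add: vclosed)
      also have "\<dots> \<le> vnorm S b * d'"
        using a(2) ac x bc by (intro mult_left_mono) (auto simp: vdist_eq vnorm_nonneg)
      finally show ?thesis using d' by simp
    qed
    moreover have "cmod (vinner S ?y (U n x)) \<le> e / 3"
    proof -
      have "cmod (vinner S ?y (U n x)) \<le> vnorm S ?y * vnorm S x"
        using cmod_vinner_le[of ?y "U n x"] bc y x Uc Unorm by (simp add: vclosed)
      also have "\<dots> \<le> d * vnorm S x"
        using b(2) bc x y by (intro mult_right_mono) (auto simp: vdist_eq vnorm_nonneg)
      finally show ?thesis using d by simp
    qed
    ultimately show "norm (vinner S y (U n x) - 0) < e" using N[OF n] by simp
  qed
qed

lemma const_class_inner: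
  assumes "a \<in> carrier S" "b \<in> carrier S"
  shows "vinner (hilbert_completion S) (const_class a) (const_class b) = vinner S a b"
  using C_inner[OF cauchy_seqs_const[OF assms(1)] cauchy_seqs_const[OF assms(2)]]
  by (metis LIMSEQ_unique tendsto_const)

end

section \<open>Complete trees\<close>

text \<open>Every tree is a rooted subtree of all sufficiently deep complete trees, so the single
  sequence of translations along complete trees serves all pairs of vectors at once.\<close>

fun complete_tree :: "nat \<Rightarrow> tree" where
  "complete_tree 0 = Leaf"
| "complete_tree (Suc n) = Node (complete_tree n) (complete_tree n)"

text \<open>Each leaf of the tree receives the complete tree of the remaining depth. If
  \<open>n\<close> is smaller than the depth, truncated subtraction makes the value
  meaningless.\<close>

fun completing_forest :: "nat \<Rightarrow> tree \<Rightarrow> forest" where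
  "completing_forest n Leaf = [complete_tree n]"
| "completing_forest n (Node l r) = completing_forest (n - 1) l @ completing_forest (n - 1) r"

lemma length_completing_forest [simp]: "length (completing_forest n t) = leaves t"
  by (induction t arbitrary: n) auto

lemma completing_forest_neq_Nil [simp]: "completing_forest n t \<noteq> []"
  using length_completing_forest[of n t] leaves_pos[of t] by force

text \<open>\<open>size t\<close> counts the inner vertices of \<open>t\<close>, a crude upper bound
  for its depth.\<close>

lemma attach_completing_forest:
  "size t \<le> n \<Longrightarrow> attach (completing_forest n t) t = complete_tree n"
proof (induction t arbitrary: n)
  case (Node l r)
  then show ?case by (cases n) auto
qed simp

text \<open>The number \<open>d\<close> is the depth of the first leaf of \<open>t\<close>; what
  matters is that it does not depend on \<open>n\<close>.\<close>

lemma hd_completing_forest: "\<exists>d. \<forall>n. hd (completing_forest n t) = complete_tree (n - d)"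
proof (induction t)
  case Leaf
  show ?case by (intro exI[of _ 0]) simp
next
  case (Node l r)
  then obtain d where "\<And>n. hd (completing_forest n l) = complete_tree (n - d)" by blast
  then show ?case by (intro exI[of _ "Suc d"]) simp
qed

lemma last_completing_forest: "\<exists>d. \<forall>n. last (completing_forest n t) = complete_tree (n - d)"
proof (induction t)
  case Leaf
  show ?case by (intro exI[of _ 0]) simp
next
  case (Node l r)
  then obtain d where "\<And>n. last (completing_forest n r) = complete_tree (n - d)" by blast
  then show ?case by (intro exI[of _ "Suc d"]) simp
qed

lemma Phi_tree_neq_Nil [simp]: "Phi_tree A B t x \<noteq> []"
  using length_Phi_tree[of A B t x] leaves_pos[of t] by force

text \<open>The path to the first leaf turns left \<open>n\<close> times, and each left turn applies
  \<open>A\<close>. Symmetrically, the path to the last leaf applies \<open>B\<close> each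
  time.\<close>

lemma hd_Phi_complete_tree: "hd (Phi_tree A B (complete_tree n) x) = (A ^^ n) x"
  by (induction n arbitrary: x) (auto simp: funpow_swap1)

lemma last_Phi_complete_tree: "last (Phi_tree A B (complete_tree n) x) = (B ^^ n) x"
  by (induction n arbitrary: x) (auto simp: funpow_swap1)

lemma hd_Phi:
  assumes "length \<xi> = length f" "f \<noteq> []"
  shows "hd (Phi A B f \<xi>) = hd (Phi_tree A B (hd f) (hd \<xi>))"
  using assms by (cases f; cases \<xi>) auto

lemma last_Phi:
  assumes "length \<xi> = length f" "f \<noteq> []"
  shows "last (Phi A B f \<xi>) = last (Phi_tree A B (last f) (last \<xi>))"
proof -
  have "\<xi> \<noteq> []" using assms by force
  then obtain \<eta> x g t where "\<xi> = \<eta> @ [x]" "f = g @ [t]" using assms by (metis rev_exhaust)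
  then show ?thesis using assms by (simp add: Phi_append)
qed

section \<open>Translations moving everything into the first leaf\<close>

definition norm_sq :: "'h::complex_inner list \<Rightarrow> real" where
  "norm_sq \<xi> = (\<Sum>x\<leftarrow>\<xi>. (norm x)\<^sup>2)"

lemma norm_sq_simps [simp]:
  "norm_sq [] = 0" "norm_sq (x # \<xi>) = (norm x)\<^sup>2 + norm_sq \<xi>" "norm_sq (\<xi> @ \<eta>) = norm_sq \<xi> + norm_sq \<eta>"
  by (simp_all add: norm_sq_def)

lemma norm_sq_nonneg [simp]: "0 \<le> norm_sq \<xi>"
  by (induction \<xi>) auto

text \<open>Cauchy-Schwarz for decorations of a tree. The induction step combines the bounds for
  head and tail by Cauchy-Schwarz in the real plane.\<close>

lemma cmod_sum_list_cinner_le: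
  "length \<xi> = length \<eta> \<Longrightarrow> cmod (sum_list (map2 cinner \<xi> \<eta>)) \<le> sqrt (norm_sq \<xi>) * sqrt (norm_sq \<eta>)"
proof (induction \<xi> \<eta> rule: list_induct2)
  case (Cons x \<xi> y \<eta>)
  have "cmod (sum_list (map2 cinner (x # \<xi>) (y # \<eta>))) \<le> cmod (cinner x y) + cmod (sum_list (map2 cinner \<xi> \<eta>))"
    by (simp add: norm_triangle_ineq)
  also have "\<dots> \<le> norm x * norm y + sqrt (norm_sq \<xi>) * sqrt (norm_sq \<eta>)"
    using Cons cmod_cinner_le by (intro add_mono)
  also have "\<dots> = inner (norm x, sqrt (norm_sq \<xi>)) (norm y, sqrt (norm_sq \<eta>))" by simp
  also have "\<dots> \<le> norm (norm x, sqrt (norm_sq \<xi>)) * norm (norm y, sqrt (norm_sq \<eta>))"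
    by (rule norm_cauchy_schwarz)
  also have "\<dots> = sqrt (norm_sq (x # \<xi>)) * sqrt (norm_sq (y # \<eta>))" by (simp add: norm_Pair)
  finally show ?case .
qed simp

text \<open>As a homeomorphism, \<open>translation s\<close> maps all leaves of \<open>s\<close> but the last one into the first leaf
  of \<open>s\<close>, so it moves vectors supported away from the two extreme leaves to orthogonal ones.\<close>

definition translation :: "tree \<Rightarrow> (tree \<times> tree) set" where
  "translation s = F_class (attach (s # replicate (leaves s - 1) Leaf) s)
     (attach (replicate (leaves s - 1) Leaf @ [s]) s)"

lemma translation_closed: "translation s \<in> carrier thompson_F"
  unfolding translation_def using leaves_pos[of s]
  by (intro F_class_closed) (simp add: leaves_attach)

section \<open>Matrix coefficients of the translations\<close>

context
  fixes A B :: "'h::chilbert_space \<Rightarrow> 'h"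
  assumes AB: "pythagorean_pair A B"
begin

lemma norm_sq_Phi_tree: "norm_sq (Phi_tree A B t x) = (norm x)\<^sup>2"
proof -
  have "complex_of_real (norm_sq (Phi_tree A B t x)) = complex_of_real ((norm x)\<^sup>2)"
    using sum_list_cinner_self[OF AB, of "Phi_tree A B t x"] Phi_tree_cinner[OF AB, of t x x]
    by (simp add: norm_sq_def cinner_self)
  then show ?thesis by (simp only: of_real_eq_iff)
qed

lemma vnorm_limit_class:
  "length \<xi> = leaves t \<Longrightarrow> vnorm (direct_limit A B) (limit_class A B t \<xi>) = sqrt (norm_sq \<xi>)"
  by (simp add: vnorm_def direct_limit_inner[OF AB] sum_list_cinner_self[OF AB] norm_sq_def)

text \<open>After the translation, \<open>w\<close> and the image of \<open>z\<close> are compared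
  on \<open>s\<close> with a copy of \<open>s\<close> attached at its first leaf. On that copy
  \<open>w\<close> carries only the refinement of \<open>hd \<eta>\<close>; on the other leaves the
  image carries only part of the refinement of \<open>last \<xi>\<close>.\<close>

lemma translation_inner_le:
  assumes \<xi>: "length \<xi> = leaves s" and \<eta>: "length \<eta> = leaves s"
  defines "z \<equiv> limit_class A B s \<xi>" and "w \<equiv> limit_class A B s \<eta>"
  shows "cmod (vinner (direct_limit A B) w (limit_rep A B (translation s) z)) \<le>
    norm (hd \<eta>) * vnorm (direct_limit A B) z + vnorm (direct_limit A B) w * norm (last \<xi>)"
proof -
  define m where "m = leaves s - 1"
  have m: "leaves s = Suc m" using leaves_pos[of s] by (simp add: m_def)
  obtain \<xi>0 x where x: "\<xi> = \<xi>0 @ [x]" "length \<xi>0 = m"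
    using \<xi> m by (metis length_Suc_conv_rev)
  obtain y \<eta>0 where y: "\<eta> = y # \<eta>0" "length \<eta>0 = m"
    using \<eta> m by (metis length_Suc_conv)
  obtain u us where u: "Phi_tree A B s x = u # us" "length us = m"
    using length_Phi_tree[of A B s x] m by (metis length_Suc_conv)
  \<comment> \<open>\<open>?f\<close> attaches \<open>s\<close> at the first leaf of
    \<open>s\<close> and \<open>?f'\<close> at the last leaf: these give the target and the source
    tree of the translation.\<close>
  let ?f = "s # replicate m Leaf" and ?f' = "replicate m Leaf @ [s]"
  have len: "length ?f = leaves s" "length ?f' = leaves s" using m by simp_all
  have lv: "leaves (attach ?f s) = Suc m + m" "leaves (attach ?f' s) = Suc m + m"
    using len m by (simp_all add: leaves_attach)
  \<comment> \<open>The bracketing anticipates the split below: the attached copy of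
    \<open>s\<close> has \<open>Suc m\<close> leaves but \<open>\<xi>0\<close> only \<open>m\<close>
    entries, so \<open>u\<close> joins the first block.\<close>
  have P': "Phi A B ?f' \<xi> = (\<xi>0 @ [u]) @ us"
    using x u by (simp add: Phi_append)
  have P: "Phi A B ?f \<eta> = Phi_tree A B s y @ \<eta>0"
    using y by simp
  have zeq: "z = limit_class A B (attach ?f' s) ((\<xi>0 @ [u]) @ us)"
    using limit_class_attach[OF AB \<xi> len(2)] P' by (simp add: z_def)
  have weq: "w = limit_class A B (attach ?f s) (Phi_tree A B s y @ \<eta>0)"
    using limit_class_attach[OF AB \<eta> len(1)] P by (simp add: w_def)
  \<comment> \<open>The action keeps the decorations and replaces the source tree by the target
    tree.\<close>
  have "limit_rep A B (translation s) z = limit_class A B (attach ?f s) ((\<xi>0 @ [u]) @ us)"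
    unfolding zeq translation_def m_def[symmetric]
    using lv x u by (intro limit_rep_class[OF AB]) auto
  then have "vinner (direct_limit A B) w (limit_rep A B (translation s) z) =
      sum_list (map2 cinner (Phi_tree A B s y @ \<eta>0) ((\<xi>0 @ [u]) @ us))"
    unfolding weq using lv m x y u by (simp add: direct_limit_inner[OF AB])
  also have "\<dots> = sum_list (map2 cinner (Phi_tree A B s y) (\<xi>0 @ [u])) + sum_list (map2 cinner \<eta>0 us)"
    using m x y u by (subst zip_append) simp_all
  finally have "cmod (vinner (direct_limit A B) w (limit_rep A B (translation s) z)) \<le>
      cmod (sum_list (map2 cinner (Phi_tree A B s y) (\<xi>0 @ [u]))) + cmod (sum_list (map2 cinner \<eta>0 us))"
    by (simp add: norm_triangle_ineq)
  moreover have "cmod (sum_list (map2 cinner (Phi_tree A B s y) (\<xi>0 @ [u]))) \<le> norm (hd \<eta>) * vnorm (direct_limit A B) z"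
  proof -
    have "cmod (sum_list (map2 cinner (Phi_tree A B s y) (\<xi>0 @ [u]))) \<le> norm y * sqrt (norm_sq (\<xi>0 @ [u]))"
      using cmod_sum_list_cinner_le[of "Phi_tree A B s y" "\<xi>0 @ [u]"] m x by (simp add: norm_sq_Phi_tree)
    also have "sqrt (norm_sq (\<xi>0 @ [u])) \<le> sqrt (norm_sq ((\<xi>0 @ [u]) @ us))" by simp
    also have "\<dots> = vnorm (direct_limit A B) z"
      unfolding zeq using lv x u by (simp add: vnorm_limit_class)
    finally show ?thesis using y by (simp add: mult_left_mono)
  qed
  moreover have "cmod (sum_list (map2 cinner \<eta>0 us)) \<le> vnorm (direct_limit A B) w * norm (last \<xi>)"
  proof -
    have "norm_sq us \<le> norm_sq (u # us)" by simp
    also have "\<dots> = (norm x)\<^sup>2" unfolding u(1)[symmetric] by (rule norm_sq_Phi_tree)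
    finally have us: "sqrt (norm_sq us) \<le> norm x" by (simp add: real_le_lsqrt)
    have "cmod (sum_list (map2 cinner \<eta>0 us)) \<le> sqrt (norm_sq \<eta>0) * sqrt (norm_sq us)"
      by (rule cmod_sum_list_cinner_le) (use y u in simp)
    also have "\<dots> \<le> sqrt (norm_sq \<eta>) * norm x"
      using us y by (intro mult_mono) simp_all
    finally show ?thesis using x \<eta> by (simp add: w_def vnorm_limit_class)
  qed
  ultimately show ?thesis by linarith
qed

text \<open>Rewritten on a deep complete tree, the extreme decorations of the two vectors are a
  power of \<open>A\<close> and a power of \<open>B\<close> applied to fixed vectors, so both terms
  of the bound for translations tend to zero.\<close>

lemma translation_complete_tree_weakly_null:
  assumes A: "\<And>\<xi>. (\<lambda>n. (A ^^ n) \<xi>) \<longlonglongrightarrow> 0" and B: "\<And>\<xi>. (\<lambda>n. (B ^^ n) \<xi>) \<longlonglongrightarrow> 0"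
    and X: "X \<in> carrier (direct_limit A B)" and Y: "Y \<in> carrier (direct_limit A B)"
  shows "(\<lambda>n. vinner (direct_limit A B) Y (limit_rep A B (translation (complete_tree n)) X)) \<longlonglongrightarrow> 0"
proof -
  obtain t \<xi> \<eta> where \<xi>: "length \<xi> = leaves t" and \<eta>: "length \<eta> = leaves t"
    and XY: "X = limit_class A B t \<xi>" "Y = limit_class A B t \<eta>"
    using direct_limit_common[OF AB X Y] by blast
  obtain d where d: "\<And>n. hd (completing_forest n t) = complete_tree (n - d)"
    using hd_completing_forest by blast
  obtain d' where d': "\<And>n. last (completing_forest n t) = complete_tree (n - d')"
    using last_completing_forest by blast
  let ?x = "vnorm (direct_limit A B) X" and ?y = "vnorm (direct_limit A B) Y"
  let ?b = "\<lambda>n. norm ((A ^^ (n - d)) (hd \<eta>)) * ?x + ?y * norm ((B ^^ (n - d')) (last \<xi>))"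
  have shift: "(\<lambda>n. f (n - k)) \<longlonglongrightarrow> 0" if "f \<longlonglongrightarrow> 0" for f :: "nat \<Rightarrow> 'h" and k
    by (rule LIMSEQ_offset[where k = k]) (simp add: that)
  have "?b \<longlonglongrightarrow> 0"
    by (intro tendsto_add_zero tendsto_mult_left_zero tendsto_mult_right_zero tendsto_norm_zero shift A B)
  \<comment> \<open>The bound is available only once the complete tree of depth \<open>n\<close>
    refines the common tree \<open>t\<close>.\<close>
  moreover have "eventually (\<lambda>n. cmod (vinner (direct_limit A B) Y
      (limit_rep A B (translation (complete_tree n)) X)) \<le> ?b n) sequentially"
    using eventually_ge_at_top[of "size t"]
  proof eventually_elim
    case (elim n)
    let ?f = "completing_forest n t"
    have att: "attach ?f t = complete_tree n" using elim by (rule attach_completing_forest)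
    have len: "length (Phi A B ?f \<xi>) = leaves (complete_tree n)" "length (Phi A B ?f \<eta>) = leaves (complete_tree n)"
      using \<xi> \<eta> leaves_attach[of ?f t] att by simp_all
    have "X = limit_class A B (complete_tree n) (Phi A B ?f \<xi>)" "Y = limit_class A B (complete_tree n) (Phi A B ?f \<eta>)"
      using limit_class_attach[OF AB \<xi>, of ?f] limit_class_attach[OF AB \<eta>, of ?f] att XY by simp_all
    moreover have "hd (Phi A B ?f \<eta>) = (A ^^ (n - d)) (hd \<eta>)" "last (Phi A B ?f \<xi>) = (B ^^ (n - d')) (last \<xi>)"
      using \<xi> \<eta> by (simp_all add: hd_Phi last_Phi d d' hd_Phi_complete_tree last_Phi_complete_tree)
    ultimately show ?case using translation_inner_le[OF len] by simp
  qed
  ultimately show ?thesis by (rule Lim_null_comparison[rotated])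
qed

end

section \<open>Passage from the direct limit to its completion\<close>

theorem corollaryE:
  fixes A B :: "'h::chilbert_space \<Rightarrow> 'h"
  assumes "pythagorean_pair A B"
    and "\<And>\<xi>. (\<lambda>n. (A ^^ n) \<xi>) \<longlonglongrightarrow> 0"
    and "\<And>\<xi>. (\<lambda>n. (B ^^ n) \<xi>) \<longlonglongrightarrow> 0"
  shows "weakly_mixing thompson_F (pyth_space A B) (pyth_rep A B)"
proof -
  note AB = assms(1)
  interpret K: complex_inner_space "direct_limit A B"
    by (rule complex_inner_space_direct_limit[OF AB])
  interpret H: complex_inner_space "pyth_space A B"
    unfolding pyth_space_def by (rule K.complex_inner_space_completion)
  let ?g = "\<lambda>n. translation (complete_tree n)"
  have rep: "unitary_representation thompson_F (pyth_space A B) (pyth_rep A B)"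
    by (rule unitary_representation_pyth_rep[OF AB])
  show ?thesis
  proof (rule H.weakly_mixingI[OF rep translation_closed])
    fix X Y assume XY: "X \<in> carrier (pyth_space A B)" "Y \<in> carrier (pyth_space A B)"
    show "(\<lambda>n. vinner (pyth_space A B) Y (pyth_rep A B (?g n) X)) \<longlonglongrightarrow> 0"
    \<comment> \<open>The classes of constant sequences form the copy of the direct limit in its
      completion; they are dense, and the matrix coefficients between them are those of the direct
      limit.\<close>
    proof (rule H.weakly_null_isometries_from_dense[where D = "K.const_class ` carrier (direct_limit A B)", OF _ _ _ _ XY])
      show "unitary_operator (pyth_space A B) (pyth_rep A B (?g n))" for n
        using rep translation_closed by (simp add: unitary_representation_def)
      show "K.const_class ` carrier (direct_limit A B) \<subseteq> carrier (pyth_space A B)"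
        by (auto simp: pyth_space_def intro!: K.cauchy_class_closed K.cauchy_seqs_const)
    next
      fix Z e assume "Z \<in> carrier (pyth_space A B)" and e: "0 < (e::real)"
      then obtain z where z: "z \<in> cauchy_seqs (direct_limit A B)" "Z = cauchy_class (direct_limit A B) z"
        by (auto simp: pyth_space_def K.carrier_completion)
      show "\<exists>a\<in>K.const_class ` carrier (direct_limit A B). vdist (pyth_space A B) a Z \<le> e"
        using K.const_class_approx[OF z(1) e] K.cauchy_seqsD[OF z(1)] z(2)
        unfolding pyth_space_def by (metis imageI order_refl)
    next
      fix P Q assume "P \<in> K.const_class ` carrier (direct_limit A B)" "Q \<in> K.const_class ` carrier (direct_limit A B)"
      then obtain a b where ab: "a \<in> carrier (direct_limit A B)" "b \<in> carrier (direct_limit A B)"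
        "P = K.const_class a" "Q = K.const_class b" by blast
      have "pyth_rep A B g P = K.const_class (limit_rep A B g a)" if g: "g \<in> carrier thompson_F" for g
        unfolding pyth_rep_def ab(3)
        using K.completion_map_class[where T = "limit_rep A B g", OF limit_rep_closed[OF AB g]
            limit_rep_add[OF AB g] limit_rep_scale[OF AB g] limit_rep_inner[OF AB g] K.cauchy_seqs_const[OF ab(1)]]
        by simp
      then have "vinner (pyth_space A B) Q (pyth_rep A B (?g n) P) =
          vinner (direct_limit A B) b (limit_rep A B (?g n) a)" for n
        using ab K.const_class_inner[OF ab(2) limit_rep_closed[OF AB translation_closed ab(1)]]
        by (simp add: pyth_space_def translation_closed)
      then show "(\<lambda>n. vinner (pyth_space A B) Q (pyth_rep A B (?g n) P)) \<longlonglongrightarrow> 0"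
        using translation_complete_tree_weakly_null[OF assms ab(1,2)] by simp
    qed
  qed
qed

end
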